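(* Let $W_n=(\mathbb{C}^n,\|\cdot\|)$ be a symmetric Banach space such that $\chi((e_k))=1$, where $(e_k)$ denotes the canonical basis for $W_n$. Let $X$ be a Banach space and define the number $b_n(\lambda)$ as $$b_n(\lambda):=B(B_{W_n},X,\lambda)\,B(B_{W_n^*},X,\lambda).$$ Then $$b_n(\lambda)\ \le\ \frac{(8\lambda^2e^6\log n)\,d(W_n,\ell_2^n)}{n},$$ where $d(W_n,\ell_2^n)$ is the Banach–Mazur distance. Consequently, $\lim_{n\to\infty}b_n(\lambda)=0$.
   Context: All Banach spaces are over $\mathbb{C}$. $B_W$ denotes the (open) unit ball of a Banach space $W$, and $W^*$ the dual space of $W$; the dual $W_n^*$ is regarded as $\mathbb{C}^n$ with the dual norm. $\ell_2^n=(\mathbb{C}^n,\|\cdot\|_2)$. A Schauder basis $(x_k)$ of a Banach space $W$ is unconditional if there is a constant $K\ge 0$ with $\|\sum_k\zeta_ka_kx_k\|\le K\|\sum_ka_kx_k\|$ for all $\zeta_k,a_k\in\mathbb{C}$ with $|\zeta_k|\le1$; the best such $K$ is the unconditional basis constant $\chi((x_k))$. A basis $(x_k)$ of $W$ is symmetric if for each permutation $\sigma$ of the indices, (a) $(x_{\sigma(k)})$ is also a basis of $W$, and (b) $(x_k)$ and $(x_{\sigma(k)})$ are equivalent, meaning that $\sum_ka_kx_k$ converges if and only if $\sum_ka_kx_{\sigma(k)}$ converges. A Banach space with a symmetric basis is called a symmetric Banach space. The Banach–Mazur distance between normed spaces $U,V$ is $d(U,V)=\inf\{\|S\|\,\|S^{-1}\|: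 S \text{ is an invertible operator from } U \text{ to } V\}$. A domain $\Omega\subseteq\mathbb{C}^n$ is complete Reinhardt if $(z_1,\dots,z_n)\in\Omega$ and $|\mu_k|\le 1$ for all $k$ imply $(\mu_1z_1,\dots,\mu_nz_n)\in\Omega$. Multi-indices: $\alpha\in\mathbb{N}_0^n$, $z^\alpha=z_1^{\alpha_1}\cdots z_n^{\alpha_n}$. For $r\ge 0$, $r\cdot\Omega=\{rz:z\in\Omega\}$. Definition ($\lambda$-second Bohr radius). Let $\Omega\subset\mathbb{C}^n$ be a bounded complete Reinhardt domain, $X,Y$ Banach spaces, and $T:X\to Y$ a non-null bounded linear operator with $\|T\|\le\lambda$. Then $B(\Omega,T,\lambda)$ is the largest $r\ge 0$ such that $$\sum_{\alpha\in\mathbb{N}_0^n}\ \sup_{z\in r\cdot\Omega}\|T(a_\alpha)z^\alpha\|_Y\ \le\ \lambda\sup_{z\in\Omega}\|f(z)\|_X$$ holds for all $X$-valued analytic functions $f$ on $\Omega$ with series expansion $f(z)=\sum_{\alpha\in\mathbb{N}_0^n}a_\alpha z^\alpha$, $a_\alpha\in X$. When $T$ is the identity on $X$ (so $X\ne 0$ and $\lambda\ge 1$), write $B(\Omega,X,\lambda)$ for $B(\Omega,T,\lambda)$.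
   Formalization: The inequality is stated for n ≥ 2: at n = 1 the right side is 0 because log 1 = 0, while for X = ℂ, λ = 1 one has b_1 = 1/9 > 0, so the printed bound fails there. *)

theory Defs
  imports
    "Jordan_Normal_Form.Matrix"
    "HOL-Analysis.Infinite_Sum"
    "HOL-Analysis.L2_Norm"
    "HOL-Combinatorics.Permutations"
begin

section \<open>Complex Banach spaces\<close>

class complex_banach = banach +
  fixes scaleC :: "complex \<Rightarrow> 'a \<Rightarrow> 'a" (infixr "*\<^sub>C" 75)
  assumes scaleC_add_right: "c *\<^sub>C (x + y) = c *\<^sub>C x + c *\<^sub>C y"
    and scaleC_add_left: "(c + d) *\<^sub>C x = c *\<^sub>C x + d *\<^sub>C x"
    and scaleC_scaleC: "c *\<^sub>C (d *\<^sub>C x) = (c * d) *\<^sub>C x"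
    and scaleC_of_real: "complex_of_real r *\<^sub>C x = r *\<^sub>R x"
    and norm_scaleC: "norm (c *\<^sub>C x) = cmod c * norm x"

instantiation complex :: complex_banach
begin

definition scaleC_complex_def: "c *\<^sub>C (x::complex) = c * x"

instance
  by standard (auto simp: scaleC_complex_def algebra_simps norm_mult scaleR_conv_of_real)

end


section \<open>Norms on complex coordinate space\<close>

text \<open>
  The space of complex \<open>n\<close>-tuples is \<open>carrier_vec n\<close>, and a normed space with this underlying
  vector space is given by its norm function, of which only the values on \<open>carrier_vec n\<close> matter.
  Completeness is automatic in finite dimension.
\<close>

definition norm_on :: "nat \<Rightarrow> (complex vec \<Rightarrow> real) \<Rightarrow> bool" where
  "norm_on n N \<longleftrightarrow>
     (\<forall>z\<in>carrier_vec n. 0 \<le> N z) \<and>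
     (\<forall>z\<in>carrier_vec n. N z = 0 \<longleftrightarrow> z = 0\<^sub>v n) \<and>
     (\<forall>z\<in>carrier_vec n. \<forall>c. N (c \<cdot>\<^sub>v z) = cmod c * N z) \<and>
     (\<forall>z\<in>carrier_vec n. \<forall>w\<in>carrier_vec n. N (z + w) \<le> N z + N w)"

definition unit_ball :: "nat \<Rightarrow> (complex vec \<Rightarrow> real) \<Rightarrow> complex vec set" where
  "unit_ball n N = {z \<in> carrier_vec n. N z < 1}"

text \<open>The dual pairing is the bilinear one, without conjugation.\<close>

definition dual_norm :: "nat \<Rightarrow> (complex vec \<Rightarrow> real) \<Rightarrow> complex vec \<Rightarrow> real" where
  "dual_norm n N w = (SUP z\<in>{z \<in> carrier_vec n. N z \<le> 1}. cmod (w \<bullet> z))"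

definition l2_norm :: "nat \<Rightarrow> complex vec \<Rightarrow> real" where
  "l2_norm n z = L2_set (\<lambda>i. cmod (z $ i)) {..<n}"


section \<open>Banach--Mazur distance\<close>

definition op_norm :: "nat \<Rightarrow> (complex vec \<Rightarrow> real) \<Rightarrow> (complex vec \<Rightarrow> real) \<Rightarrow> complex mat \<Rightarrow> real" where
  "op_norm n N M S = (SUP z\<in>{z \<in> carrier_vec n. N z \<le> 1}. M (S *\<^sub>v z))"

text \<open>The linear operators between two normed spaces on \<open>carrier_vec n\<close> are the square matrices;
  all of them are bounded.\<close>

definition banach_mazur :: "nat \<Rightarrow> (complex vec \<Rightarrow> real) \<Rightarrow> (complex vec \<Rightarrow> real) \<Rightarrow> real" where
  "banach_mazur n N M = Inf {op_norm n N M S * op_norm n M N S' | S S'.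
     S \<in> carrier_mat n n \<and> S' \<in> carrier_mat n n \<and> inverts_mat S S' \<and> inverts_mat S' S}"


section \<open>Bases\<close>

text \<open>
  Bases of an \<open>n\<close>-dimensional space are indexed by \<open>{..<n}\<close>, so the partial sums of
  an expansion are constant from index \<open>n\<close> on.
\<close>

definition partial_sum :: "nat \<Rightarrow> (nat \<Rightarrow> complex vec) \<Rightarrow> complex vec \<Rightarrow> nat \<Rightarrow> complex vec" where
  "partial_sum n x a m = finsum_vec TYPE(complex) n (\<lambda>k. a $ k \<cdot>\<^sub>v x k) {k. k < m \<and> k < n}"

definition series_to ::
    "nat \<Rightarrow> (complex vec \<Rightarrow> real) \<Rightarrow> (nat \<Rightarrow> complex vec) \<Rightarrow> complex vec \<Rightarrow> complex vec \<Rightarrow> bool" where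
  "series_to n N x a z \<longleftrightarrow>
     z \<in> carrier_vec n \<and> (\<lambda>m. N (z - partial_sum n x a m)) \<longlonglongrightarrow> 0"

definition schauder_basis :: "nat \<Rightarrow> (complex vec \<Rightarrow> real) \<Rightarrow> (nat \<Rightarrow> complex vec) \<Rightarrow> bool" where
  "schauder_basis n N x \<longleftrightarrow>
     (\<forall>k<n. x k \<in> carrier_vec n) \<and>
     (\<forall>z\<in>carrier_vec n. \<exists>!a. a \<in> carrier_vec n \<and> series_to n N x a z)"

definition unconditional_bound ::
    "nat \<Rightarrow> (complex vec \<Rightarrow> real) \<Rightarrow> (nat \<Rightarrow> complex vec) \<Rightarrow> real \<Rightarrow> bool" where
  "unconditional_bound n N x K \<longleftrightarrow> 0 \<le> K \<and>
     (\<forall>\<zeta>\<in>carrier_vec n. \<forall>a\<in>carrier_vec n. (\<forall>k<n. cmod (\<zeta> $ k) \<le> 1) \<longrightarrow>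
        N (finsum_vec TYPE(complex) n (\<lambda>k. (\<zeta> $ k * a $ k) \<cdot>\<^sub>v x k) {..<n})
          \<le> K * N (finsum_vec TYPE(complex) n (\<lambda>k. a $ k \<cdot>\<^sub>v x k) {..<n}))"

definition unconditional_basis :: "nat \<Rightarrow> (complex vec \<Rightarrow> real) \<Rightarrow> (nat \<Rightarrow> complex vec) \<Rightarrow> bool" where
  "unconditional_basis n N x \<longleftrightarrow> schauder_basis n N x \<and> (\<exists>K. unconditional_bound n N x K)"

definition unconditional_const :: "nat \<Rightarrow> (complex vec \<Rightarrow> real) \<Rightarrow> (nat \<Rightarrow> complex vec) \<Rightarrow> real" where
  "unconditional_const n N x = (LEAST K. unconditional_bound n N x K)"

text \<open>
  Pitfall: symmetry only asks for equivalence of the permuted bases, not for invariance of the norm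
  under permutations.  In finite dimension every series in question converges, so every basis is
  symmetric in this sense.
\<close>

definition symmetric_basis :: "nat \<Rightarrow> (complex vec \<Rightarrow> real) \<Rightarrow> (nat \<Rightarrow> complex vec) \<Rightarrow> bool" where
  "symmetric_basis n N x \<longleftrightarrow> schauder_basis n N x \<and>
     (\<forall>\<sigma>. \<sigma> permutes {..<n} \<longrightarrow>
        schauder_basis n N (\<lambda>k. x (\<sigma> k)) \<and>
        (\<forall>a\<in>carrier_vec n.
           (\<exists>z. series_to n N x a z) \<longleftrightarrow> (\<exists>z. series_to n N (\<lambda>k. x (\<sigma> k)) a z)))"

definition symmetric_space :: "nat \<Rightarrow> (complex vec \<Rightarrow> real) \<Rightarrow> bool" where
  "symmetric_space n N \<longleftrightarrow> norm_on n N \<and> (\<exists>x. symmetric_basis n N x)"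


section \<open>The second Bohr radius\<close>

text \<open>Multi-indices of length \<open>n\<close> are the elements of \<open>carrier_vec n\<close> over \<open>nat\<close>.\<close>

definition monomial :: "nat vec \<Rightarrow> complex vec \<Rightarrow> complex" where
  "monomial \<alpha> z = (\<Prod>i<dim_vec \<alpha>. z $ i ^ (\<alpha> $ i))"

text \<open>Analyticity means local expansion into power series; \<open>has_sum\<close> is unconditional summation.
  The requirement \<open>z \<in> \<Omega>\<close> makes \<open>\<Omega>\<close> a neighbourhood of each of its points.\<close>

definition analytic_Cn :: "nat \<Rightarrow> complex vec set \<Rightarrow> (complex vec \<Rightarrow> 'x::complex_banach) \<Rightarrow> bool" where
  "analytic_Cn n \<Omega> f \<longleftrightarrow> (\<forall>w\<in>\<Omega>. \<exists>\<epsilon>>0. \<exists>c. \<forall>z\<in>carrier_vec n.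
     (\<forall>i<n. cmod (z $ i - w $ i) < \<epsilon>) \<longrightarrow>
       z \<in> \<Omega> \<and> ((\<lambda>\<alpha>. monomial \<alpha> (z - w) *\<^sub>C c \<alpha>) has_sum f z) (carrier_vec n))"

definition monomial_expansion ::
    "nat \<Rightarrow> complex vec set \<Rightarrow> (complex vec \<Rightarrow> 'x::complex_banach) \<Rightarrow> (nat vec \<Rightarrow> 'x) \<Rightarrow> bool" where
  "monomial_expansion n \<Omega> f a \<longleftrightarrow>
     (\<forall>z\<in>\<Omega>. ((\<lambda>\<alpha>. monomial \<alpha> z *\<^sub>C a \<alpha>) has_sum f z) (carrier_vec n))"

text \<open>Suprema and sums are taken in \<open>ennreal\<close>, so the inequality is void for unbounded \<open>f\<close>.\<close>

definition bohr_inequality ::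
    "nat \<Rightarrow> complex vec set \<Rightarrow> ('x::complex_banach \<Rightarrow> 'y::complex_banach) \<Rightarrow> real \<Rightarrow> real \<Rightarrow> bool" where
  "bohr_inequality n \<Omega> T lam r \<longleftrightarrow> (\<forall>f a. analytic_Cn n \<Omega> f \<and> monomial_expansion n \<Omega> f a \<longrightarrow>
     (\<Sum>\<^sub>\<infinity>\<alpha>\<in>carrier_vec n.
        (SUP z\<in>(\<lambda>z. complex_of_real r \<cdot>\<^sub>v z) ` \<Omega>. ennreal (norm (monomial \<alpha> z *\<^sub>C T (a \<alpha>)))))
       \<le> ennreal lam * (SUP z\<in>\<Omega>. ennreal (norm (f z))))"

text \<open>
  Meant for a bounded complete Reinhardt domain \<open>\<Omega>\<close> in dimension \<open>n \<ge> 1\<close> and a bounded complex-linear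
  \<open>T \<noteq> 0\<close> of norm at most \<open>lam\<close>.  The set of admissible \<open>r\<close> is then a compact interval
  containing \<open>0\<close>, so that the greatest element exists.
\<close>

definition second_bohr_radius ::
    "nat \<Rightarrow> complex vec set \<Rightarrow> ('x::complex_banach \<Rightarrow> 'y::complex_banach) \<Rightarrow> real \<Rightarrow> real" where
  "second_bohr_radius n \<Omega> T lam = (GREATEST r. 0 \<le> r \<and> bohr_inequality n \<Omega> T lam r)"

definition second_bohr_radius_space ::
    "nat \<Rightarrow> complex vec set \<Rightarrow> 'x::complex_banach itself \<Rightarrow> real \<Rightarrow> real" where
  "second_bohr_radius_space n \<Omega> X lam = second_bohr_radius n \<Omega> (id :: 'x \<Rightarrow> 'x) lam"

definition bohr_product ::
    "nat \<Rightarrow> (complex vec \<Rightarrow> real) \<Rightarrow> 'x::complex_banach itself \<Rightarrow> real \<Rightarrow> real" where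
  "bohr_product n N X lam =
     second_bohr_radius_space n (unit_ball n N) X lam *
     second_bohr_radius_space n (unit_ball n (dual_norm n N)) X lam"

end

theory Submission
  imports
    Defs
    "HOL-Combinatorics.Multiset_Permutations"
    "HOL-Analysis.Convex"
    "HOL-Real_Asymp.Real_Asymp"
begin

text \<open>
  For each \<open>m\<close> there is an \<open>m\<close>-homogeneous polynomial \<open>P(z) = \<Sum> \<epsilon>\<^sub>\<alpha> (m!/\<alpha>!) z\<^sup>\<alpha>\<close> with \<open>|\<epsilon>\<^sub>\<alpha>| = 1\<close> and
  \<open>|P(z)|\<^sup>2 \<le> n m! (mn + 1) \<parallel>z\<parallel>\<^sub>2\<^bsup>2m\<^esup>\<close>.  Applied to \<open>P(s\<^sub>1z\<^sub>1, \<dots>, s\<^sub>nz\<^sub>n)\<close> with weights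
  \<open>s\<^sub>i > 0\<close>, the Bohr inequality bounds \<open>r sup (\<Sum> s\<^sub>i|z\<^sub>i|)\<close> over the ball of \<open>W\<close> in terms of \<open>A\<close>, the
  norm of \<open>diag s : W \<rightarrow> \<ell>\<^sub>2\<close>.  With weights \<open>1/s\<^sub>i\<close> the same holds for \<open>W\<^sup>*\<close> and \<open>B\<close>, the norm of the
  inverse \<open>\<ell>\<^sub>2 \<rightarrow> W\<close>.  Since \<open>s\<close> itself, normalized in \<open>W\<^sup>*\<close>, is a test vector, the two suprema have
  product at least \<open>n\<close>, and \<open>m \<approx> log n\<close> gives \<open>b\<^sub>n \<le> C \<lambda>\<^sup>2 log n AB/n\<close>.

  As the norm is a lattice norm, averaging an arbitrary isomorphism \<open>W \<rightarrow> \<ell>\<^sub>2\<close> over phases replaces it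
  by a diagonal one that is no worse, so \<open>AB\<close> may be taken arbitrarily close to the Banach--Mazur
  distance.  For the limit, a weight that nearly
  maximizes \<open>\<Prod> s\<^sub>i\<^sup>2\<close> subject to \<open>A \<le> 1\<close> satisfies \<open>B\<^sup>2 \<le> 6n\<close>.
\<close>

section \<open>Words, multisets and averages over roots of unity\<close>

definition words :: "'a set \<Rightarrow> nat \<Rightarrow> 'a list set" where
  "words A m = {w. set w \<subseteq> A \<and> length w = m}"

lemma finite_words: "finite A \<Longrightarrow> finite (words A m)"
  unfolding words_def by (rule finite_lists_length_eq)

text \<open>Distributivity without collecting equal monomials. Since \<open>A\<close> may itself
  consist of words, the same expansion serves for sums over letters and for powers of
  polynomials.\<close>

lemma sum_words_prod_list:
  fixes g :: "'a \<Rightarrow> 'b::comm_semiring_1"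
  assumes "finite A"
  shows "(\<Sum>w\<in>words A m. prod_list (map g w)) = (\<Sum>a\<in>A. g a) ^ m"
proof (induction m)
  case 0
  have "words A 0 = {[]}" by (auto simp: words_def)
  then show ?case by simp
next
  case (Suc m)
  have eq: "words A (Suc m) = (\<lambda>(a, w). a # w) ` (A \<times> words A m)"
    unfolding words_def by (auto simp: length_Suc_conv image_iff)
  have inj: "inj_on (\<lambda>(a, w). a # w) (A \<times> words A m)" by (auto simp: inj_on_def)
  have "(\<Sum>w\<in>words A (Suc m). prod_list (map g w))
      = (\<Sum>(a, w)\<in>A \<times> words A m. g a * prod_list (map g w))"
    unfolding eq sum.reindex[OF inj] by (simp add: case_prod_unfold o_def)
  also have "\<dots> = (\<Sum>a\<in>A. g a) * (\<Sum>w\<in>words A m. prod_list (map g w))"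
    by (simp add: sum_product sum.cartesian_product)
  finally show ?case using Suc by simp
qed

section \<open>Counting lists of words by the multisets of their blocks\<close>

lemma card_permutations_of_multiset_le: "card (permutations_of_multiset M) \<le> fact (size M)"
  unfolding card_permutations_of_multiset by simp

text \<open>The blocks of \<open>W\<close> can be chosen independently, the one of type \<alpha>
  among the arrangements of \<alpha>.\<close>

lemma card_map_mset_eq:
  "finite {W. map mset W = M} \<and> card {W. map mset W = M} \<le> (\<Prod>\<alpha>\<leftarrow>M. fact (size \<alpha>))"
proof (induction M)
  case Nil
  have "{W. map mset W = []} = {[]}" by auto
  then show ?case by simp
next
  case (Cons \<alpha> M)
  have eq: "{W. map mset W = \<alpha> # M} = (\<lambda>(w, W). w # W) ` (permutations_of_multiset \<alpha> \<times> {W. map mset W = M})"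
    by (force simp: permutations_of_multiset_def image_iff map_eq_Cons_conv)
  have fin: "finite (permutations_of_multiset \<alpha> \<times> {W. map mset W = M})"
    using Cons by simp
  have "card {W. map mset W = \<alpha> # M} \<le> card (permutations_of_multiset \<alpha> \<times> {W. map mset W = M})"
    unfolding eq by (rule card_image_le[OF fin])
  also have "\<dots> \<le> fact (size \<alpha>) * (\<Prod>\<alpha>\<leftarrow>M. fact (size \<alpha>))"
    unfolding card_cartesian_product
    by (rule mult_mono[OF card_permutations_of_multiset_le]) (use Cons in auto)
  finally show ?case using fin eq by simp
qed

text \<open>The block types can be listed in at most \<open>fact (length W)\<close> orders, and then
  each block can be arranged in at most \<open>fact m\<close> ways. This becomes the collision bound
  \<open>D\<close> in \<open>small_unimodular_polynomial\<close>.\<close>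

lemma card_same_block_types:
  assumes "\<forall>w\<in>set W. length w = m"
  shows "finite {W'. mset (map mset W') = mset (map mset W)}" (is "finite ?S")
    and "card {W'. mset (map mset W') = mset (map mset W)} \<le> fact (length W) * fact m ^ length W"
proof -
  let ?P = "permutations_of_multiset (mset (map mset W))"
  have eq: "?S = (\<Union>M\<in>?P. {W'. map mset W' = M})"
    by (auto simp: permutations_of_multiset_def)
  show "finite ?S" unfolding eq using card_map_mset_eq by auto
  have c: "card {W'. map mset W' = M} \<le> fact m ^ length W" if "M \<in> ?P" for M
  proof -
    have ms: "mset M = mset (map mset W)" using that by (simp add: permutations_of_multiset_def)
    have "(\<Prod>\<alpha>\<leftarrow>M. fact (size \<alpha>)) = (\<Prod>\<alpha>\<leftarrow>map mset W. (fact (size \<alpha>) :: nat))"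
      using ms by (simp add: image_mset.compositionality flip: prod_mset_prod_list)
    also have "\<dots> = (\<Prod>w\<leftarrow>W. fact m)"
      using assms by (simp add: o_def cong: map_cong)
    also have "\<dots> = fact m ^ length W" by (simp add: map_replicate_const)
    finally show ?thesis using card_map_mset_eq[of M] by simp
  qed
  have "card ?S \<le> (\<Sum>M\<in>?P. card {W'. map mset W' = M})"
    unfolding eq by (rule card_UN_le) simp
  also have "\<dots> \<le> (\<Sum>M\<in>?P. fact m ^ length W)" by (rule sum_mono[OF c])
  also have "\<dots> = card ?P * fact m ^ length W" by simp
  also have "\<dots> \<le> fact (length W) * fact m ^ length W"
    using card_permutations_of_multiset_le[of "mset (map mset W)"] by simp
  finally show "card ?S \<le> fact (length W) * fact m ^ length W" .
qed

section \<open>Weights that separate multisets\<close>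

lemma digits_unique:
  fixes c c' :: "nat \<Rightarrow> nat"
  assumes "\<And>i. i < L \<Longrightarrow> c i < b" "\<And>i. i < L \<Longrightarrow> c' i < b"
    and "(\<Sum>i<L. c i * b ^ i) = (\<Sum>i<L. c' i * b ^ i)" and "i < L"
  shows "c i = c' i"
  using assms
proof (induction L arbitrary: c c' i)
  case 0
  then show ?case by simp
next
  case (Suc L)
  have e: "(\<Sum>i<Suc L. d i * b ^ i) = d 0 + b * (\<Sum>i<L. d (Suc i) * b ^ i)" for d :: "nat \<Rightarrow> nat"
    unfolding sum.lessThan_Suc_shift by (simp add: sum_distrib_left mult_ac)
  have c0: "c 0 < b" "c' 0 < b" using Suc.prems by auto
  have eq: "c 0 + b * (\<Sum>i<L. c (Suc i) * b ^ i) = c' 0 + b * (\<Sum>i<L. c' (Suc i) * b ^ i)"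
    using Suc.prems(3) unfolding e .
  then have z: "c 0 = c' 0" using c0 by (metis mod_less mod_mult_self2)
  then have "(\<Sum>i<L. c (Suc i) * b ^ i) = (\<Sum>i<L. c' (Suc i) * b ^ i)" using eq c0 by simp
  then have "c (Suc j) = c' (Suc j)" if "j < L" for j
    using Suc.IH[of "\<lambda>i. c (Suc i)" "\<lambda>i. c' (Suc i)" j] Suc.prems(1,2) that by auto
  then show ?case using z Suc.prems(4) by (cases i) auto
qed

text \<open>A multiset of size at most \<open>k\<close> can be recovered from the sum of the weights \<open>(k+1)\<^sup>i\<close>: these are its
  multiplicities in base \<open>k+1\<close>.\<close>

lemma sidon_weight:
  assumes "finite T"
  obtains h :: "'a \<Rightarrow> nat" where
    "\<And>M M'. \<lbrakk>set_mset M \<subseteq> T; set_mset M' \<subseteq> T; size M \<le> k; size M' \<le> k;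
       (\<Sum>x\<in>#M. h x) = (\<Sum>x\<in>#M'. h x)\<rbrakk> \<Longrightarrow> M = M'"
proof -
  obtain e where e: "bij_betw e {..<card T} T"
    using assms ex_bij_betw_nat_finite by (metis atLeast0LessThan)
  define h where "h x = (k + 1) ^ inv_into {..<card T} e x" for x
  have he: "h (e i) = (k + 1) ^ i" if "i < card T" for i
    using e that unfolding h_def by (simp add: bij_betw_inv_into_left)
  have s: "(\<Sum>x\<in>#M. h x) = (\<Sum>i<card T. count M (e i) * (k + 1) ^ i)" if "set_mset M \<subseteq> T" for M
  proof -
    have "(\<Sum>x\<in>#M. h x) = (\<Sum>x\<in>T. count M x * h x)"
      using that
    proof (induction M)
      case (add y M)
      have "(\<Sum>x\<in>T. count (add_mset y M) x * h x)
          = (\<Sum>x\<in>T. count M x * h x + (if x = y then h x else 0))"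
        by (rule sum.cong) (auto simp: algebra_simps)
      then show ?case using add assms by (simp add: sum.distrib)
    qed simp
    also have "\<dots> = (\<Sum>i<card T. count M (e i) * h (e i))"
      by (rule sum.reindex_bij_betw[OF e, symmetric])
    finally show ?thesis by (simp add: he)
  qed
  have "M = M'" if M: "set_mset M \<subseteq> T" "set_mset M' \<subseteq> T" "size M \<le> k" "size M' \<le> k"
    and eq: "(\<Sum>x\<in>#M. h x) = (\<Sum>x\<in>#M'. h x)" for M M'
  proof (rule multiset_eqI)
    fix x
    have lt: "count M y < k + 1" "count M' y < k + 1" for y
      using M(3,4) count_le_size[of M y] count_le_size[of M' y] by linarith+
    show "count M x = count M' x"
    proof (cases "x \<in> T")
      case True
      then obtain i where i: "i < card T" "x = e i" using e by (auto simp: bij_betw_def)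
      show ?thesis
        using digits_unique[of "card T" "\<lambda>i. count M (e i)" "k + 1" "\<lambda>i. count M' (e i)" i]
          lt eq s M(1,2) i by simp
    next
      case False
      then show ?thesis using M by (metis not_in_iff subsetD)
    qed
  qed
  then show ?thesis using that by blast
qed

text \<open>Parseval's identity: after expanding the square, the pair \<open>i\<close>,
  \<open>j\<close> contributes a geometric sum over a \<open>Q\<close>-th root of unity, which
  vanishes unless \<open>h i = h j\<close>, since all exponents lie below \<open>Q\<close>. With
  constant \<open>u\<close> this counts collisions of \<open>h\<close>; with injective
  \<open>h\<close> only the diagonal remains.\<close>

lemma root_of_unity_average:
  fixes u :: "'a \<Rightarrow> complex"
  assumes "finite I" and h: "\<And>i. i \<in> I \<Longrightarrow> h i < Q"
  shows "complex_of_real (\<Sum>t<Q. (cmod (\<Sum>i\<in>I. cis (2 * pi * real t / real Q) ^ h i * u i))\<^sup>2)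
    = of_nat Q * (\<Sum>i\<in>I. \<Sum>j | j \<in> I \<and> h j = h i. u i * cnj (u j))"
proof (cases "I = {}")
  case False
  define \<omega> where "\<omega> k = cis (2 * pi * real k / real Q)" for k
  from False h have Q: "Q > 0" by fastforce
  have pow: "\<omega> t ^ a = \<omega> a ^ t" for t a
    by (simp add: \<omega>_def Complex.DeMoivre mult_ac)
  have one: "\<omega> a * cnj (\<omega> a) = 1" for a
    unfolding \<omega>_def by (simp flip: complex_norm_square)
  have orth: "(\<Sum>t<Q. \<omega> t ^ a * cnj (\<omega> t ^ b)) = (if b = a then of_nat Q else 0)"
    if ab: "a < Q" "b < Q" for a b
  proof -
    define x where "x = \<omega> a * cnj (\<omega> b)"
    have eq: "(\<Sum>t<Q. \<omega> t ^ a * cnj (\<omega> t ^ b)) = (\<Sum>t<Q. x ^ t)"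
      by (intro sum.cong refl) (simp only: pow[of _ a] pow[of _ b] x_def power_mult_distrib complex_cnj_power)
    have wQ: "\<omega> c ^ Q = 1" for c
      using Q by (simp add: \<omega>_def Complex.DeMoivre)
    have xQ: "x ^ Q = 1" unfolding x_def power_mult_distrib
      by (simp add: wQ flip: complex_cnj_power)
    show ?thesis
    proof (cases "a = b")
      case True
      then have "x = 1" using one by (simp add: x_def)
      then show ?thesis using True eq by simp
    next
      case False
      have "x \<noteq> 1"
      proof
        assume "x = 1"
        then have "\<omega> a = \<omega> b" using one[of b] unfolding x_def
          by (metis mult.commute mult.left_commute mult_1)
        then show False
          using Complex.bij_betw_roots_unity[OF Q] ab False
          unfolding \<omega>_def bij_betw_def inj_on_def by blast
      qed
      then show ?thesis using False eq xQ geometric_sum[of x Q] by simp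
    qed
  qed
  have "complex_of_real (\<Sum>t<Q. (cmod (\<Sum>i\<in>I. \<omega> t ^ h i * u i))\<^sup>2)
     = (\<Sum>t<Q. \<Sum>i\<in>I. \<Sum>j\<in>I. (\<omega> t ^ h i * cnj (\<omega> t ^ h j)) * (u i * cnj (u j)))"
    by (simp only: of_real_sum complex_norm_square cnj_sum sum_product complex_cnj_mult) (simp add: mult_ac)
  also have "\<dots> = (\<Sum>i\<in>I. \<Sum>t<Q. \<Sum>j\<in>I. (\<omega> t ^ h i * cnj (\<omega> t ^ h j)) * (u i * cnj (u j)))"
    by (rule sum.swap)
  also have "\<dots> = (\<Sum>i\<in>I. \<Sum>j\<in>I. \<Sum>t<Q. (\<omega> t ^ h i * cnj (\<omega> t ^ h j)) * (u i * cnj (u j)))"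
    by (intro sum.cong refl sum.swap)
  also have "\<dots> = (\<Sum>i\<in>I. \<Sum>j\<in>I. (if h j = h i then of_nat Q else 0) * (u i * cnj (u j)))"
    by (intro sum.cong refl) (simp only: sum_distrib_right[symmetric] orth h)
  also have "\<dots> = (\<Sum>i\<in>I. \<Sum>j | j \<in> I \<and> h j = h i. of_nat Q * (u i * cnj (u j)))"
    by (rule sum.cong[OF refl], subst sum.inter_filter[OF assms(1)]) (rule sum.cong[OF refl], simp)
  finally show ?thesis by (simp add: \<omega>_def sum_distrib_left)
qed simp


section \<open>Unimodular polynomials that are small on the Hilbert ball\<close>

text \<open>Derandomized form of independent random signs: a single phase \<open>u\<close>, raised to the powers \<open>H W\<close>,
  suffices.  Cauchy--Schwarz over the classes of \<open>\<tau>\<close> reduces the claim to averaging the squared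
  coefficient sums over roots of unity \<open>u\<close>.\<close>

lemma exists_phase:
  fixes H :: "'a \<Rightarrow> nat" and \<tau> :: "'a \<Rightarrow> 'b"
  assumes fin: "finite L" and D: "\<And>W. W \<in> L \<Longrightarrow> card {W' \<in> L. H W' = H W} \<le> D"
  obtains u :: complex where "cmod u = 1"
    and "\<And>v :: 'a \<Rightarrow> complex. (\<And>W W'. \<lbrakk>W \<in> L; W' \<in> L; \<tau> W = \<tau> W'\<rbrakk> \<Longrightarrow> v W = v W') \<Longrightarrow>
      (cmod (\<Sum>W\<in>L. u ^ H W * v W))\<^sup>2 \<le> real (card (\<tau> ` L) * D) * (\<Sum>W\<in>L. (cmod (v W))\<^sup>2)"
proof -
  define F where "F \<beta> = {W \<in> L. \<tau> W = \<beta>}" for \<beta>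
  \<comment> \<open>Larger than every exponent, so that distinct exponents stay distinct modulo
    \<open>Q\<close>.\<close>
  define Q where "Q = Suc (\<Sum>W\<in>L. H W)"
  define \<omega> where "\<omega> t = cis (2 * pi * real t / real Q)" for t
  define b where "b t \<beta> = (\<Sum>W\<in>F \<beta>. \<omega> t ^ H W)" for t \<beta>
  \<comment> \<open>Dividing by the class size makes the average of each summand over
    \<open>t\<close> at most \<open>D\<close>, whatever the size of the class.\<close>
  define E where "E t = (\<Sum>\<beta>\<in>\<tau> ` L. (cmod (b t \<beta>))\<^sup>2 / card (F \<beta>))" for t
  have HQ: "H W < Q" if "W \<in> L" for W
    using member_le_sum[of W L H] fin that by (simp add: Q_def)
  have finF: "finite (F \<beta>)" for \<beta> using fin by (simp add: F_def)
  have Fpos: "card (F \<beta>) > 0" if "\<beta> \<in> \<tau> ` L" for \<beta>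
    using that finF[of \<beta>] by (auto simp: F_def card_gt_0_iff)
  have avg: "(\<Sum>t<Q. (cmod (b t \<beta>))\<^sup>2) \<le> real Q * (real (card (F \<beta>)) * real D)" for \<beta>
  proof -
    have "complex_of_real (\<Sum>t<Q. (cmod (b t \<beta>))\<^sup>2)
        = of_nat Q * (\<Sum>W\<in>F \<beta>. \<Sum>W' | W' \<in> F \<beta> \<and> H W' = H W. 1)"
      using root_of_unity_average[OF finF, of \<beta> H Q "\<lambda>_. 1"] HQ
      by (simp add: b_def \<omega>_def F_def)
    also have "\<dots> = complex_of_real (real Q * (\<Sum>W\<in>F \<beta>. real (card {W' \<in> F \<beta>. H W' = H W})))"
      by simp
    finally have "(\<Sum>t<Q. (cmod (b t \<beta>))\<^sup>2) = real Q * (\<Sum>W\<in>F \<beta>. real (card {W' \<in> F \<beta>. H W' = H W}))"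
      using of_real_eq_iff by blast
    also have "\<dots> \<le> real Q * (\<Sum>W\<in>F \<beta>. real D)"
    proof (intro mult_left_mono sum_mono)
      fix W assume W: "W \<in> F \<beta>"
      have "card {W' \<in> F \<beta>. H W' = H W} \<le> card {W' \<in> L. H W' = H W}"
        by (rule card_mono) (use fin in \<open>auto simp: F_def\<close>)
      also have "\<dots> \<le> D" using D W by (simp add: F_def)
      finally show "real (card {W' \<in> F \<beta>. H W' = H W}) \<le> real D" by simp
    qed simp
    finally show ?thesis by simp
  qed
  have "(\<Sum>t<Q. E t) = (\<Sum>\<beta>\<in>\<tau> ` L. (\<Sum>t<Q. (cmod (b t \<beta>))\<^sup>2) / card (F \<beta>))"
    unfolding E_def by (subst sum.swap) (simp add: sum_divide_distrib)
  also have "\<dots> \<le> (\<Sum>\<beta>\<in>\<tau> ` L. real Q * real D)"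
  proof (rule sum_mono)
    fix \<beta> assume "\<beta> \<in> \<tau> ` L"
    then show "(\<Sum>t<Q. (cmod (b t \<beta>))\<^sup>2) / card (F \<beta>) \<le> real Q * real D"
      using avg[of \<beta>] Fpos[of \<beta>] by (simp add: divide_le_eq mult_ac)
  qed
  also have "\<dots> = (\<Sum>t<Q. real (card (\<tau> ` L) * D))" by simp
  finally have le: "(\<Sum>t<Q. E t) \<le> (\<Sum>t<Q. real (card (\<tau> ` L) * D))" .
  \<comment> \<open>Some \<open>t\<close> does no worse than the average. It is fixed before any
    \<open>v\<close>, so one phase serves all \<open>v\<close> that are constant on the classes of
    \<tau>.\<close>
  have "\<exists>t<Q. E t \<le> real (card (\<tau> ` L) * D)"
  proof (rule ccontr)
    assume "\<not> ?thesis"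
    then have "(\<Sum>t<Q. real (card (\<tau> ` L) * D)) < (\<Sum>t<Q. E t)"
      by (intro sum_strict_mono) (auto simp: Q_def not_le lessThan_empty_iff)
    then show False using le by simp
  qed
  then obtain t where t: "E t \<le> real (card (\<tau> ` L) * D)" by blast
  show ?thesis
  proof (rule that[of "\<omega> t"])
    show "cmod (\<omega> t) = 1" by (simp add: \<omega>_def)
  next
    fix v :: "'a \<Rightarrow> complex"
    assume v: "\<And>W W'. \<lbrakk>W \<in> L; W' \<in> L; \<tau> W = \<tau> W'\<rbrakk> \<Longrightarrow> v W = v W'"
    define v' where "v' \<beta> = v (SOME W. W \<in> F \<beta>)" for \<beta>
    have v': "v W = v' (\<tau> W)" if "W \<in> L" for W
    proof -
      have "W \<in> F (\<tau> W)" using that by (simp add: F_def)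
      then have "(SOME W'. W' \<in> F (\<tau> W)) \<in> F (\<tau> W)" by (rule someI)
      then have "(SOME W'. W' \<in> F (\<tau> W)) \<in> L \<and> \<tau> (SOME W'. W' \<in> F (\<tau> W)) = \<tau> W"
        unfolding F_def by blast
      then show ?thesis unfolding v'_def using that by (intro v) auto
    qed
    have group: "(\<Sum>W\<in>L. g W) = (\<Sum>\<beta>\<in>\<tau> ` L. \<Sum>W\<in>F \<beta>. g W)" for g :: "'a \<Rightarrow> 'c::comm_monoid_add"
      unfolding F_def by (rule sum.image_gen[OF fin])
    have "(\<Sum>W\<in>L. \<omega> t ^ H W * v W) = (\<Sum>\<beta>\<in>\<tau> ` L. \<Sum>W\<in>F \<beta>. \<omega> t ^ H W * v W)"
      by (rule group)
    also have "\<dots> = (\<Sum>\<beta>\<in>\<tau> ` L. b t \<beta> * v' \<beta>)"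
      unfolding b_def sum_distrib_right by (intro sum.cong refl) (simp add: F_def v')
    finally have "cmod (\<Sum>W\<in>L. \<omega> t ^ H W * v W) \<le> (\<Sum>\<beta>\<in>\<tau> ` L. cmod (b t \<beta> * v' \<beta>))"
      by (simp only: norm_sum)
    \<comment> \<open>Inserting the root of the class size makes the first Cauchy--Schwarz factor
      \<open>E t\<close>, while in the second each class counts with its size, which restores the
      sum over \<open>L\<close>.\<close>
    also have "\<dots> = (\<Sum>\<beta>\<in>\<tau> ` L. cmod (b t \<beta>) / sqrt (card (F \<beta>)) * (sqrt (card (F \<beta>)) * cmod (v' \<beta>)))"
      by (intro sum.cong refl) (use Fpos in \<open>fastforce simp: norm_mult\<close>)
    finally have "(cmod (\<Sum>W\<in>L. \<omega> t ^ H W * v W))\<^sup>2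
      \<le> (\<Sum>\<beta>\<in>\<tau> ` L. cmod (b t \<beta>) / sqrt (card (F \<beta>)) * (sqrt (card (F \<beta>)) * cmod (v' \<beta>)))\<^sup>2"
      by (rule power_mono) simp
    also have "\<dots> \<le> (\<Sum>\<beta>\<in>\<tau> ` L. (cmod (b t \<beta>) / sqrt (card (F \<beta>)))\<^sup>2)
        * (\<Sum>\<beta>\<in>\<tau> ` L. (sqrt (card (F \<beta>)) * cmod (v' \<beta>))\<^sup>2)"
      by (rule Cauchy_Schwarz_ineq_sum)
    also have "(\<Sum>\<beta>\<in>\<tau> ` L. (cmod (b t \<beta>) / sqrt (card (F \<beta>)))\<^sup>2) = E t"
      unfolding E_def by (simp add: power_divide)
    also have "(\<Sum>\<beta>\<in>\<tau> ` L. (sqrt (card (F \<beta>)) * cmod (v' \<beta>))\<^sup>2) = (\<Sum>\<beta>\<in>\<tau> ` L. \<Sum>W\<in>F \<beta>. (cmod (v W))\<^sup>2)"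
    proof (intro sum.cong refl)
      fix \<beta>
      have "(\<Sum>W\<in>F \<beta>. (cmod (v W))\<^sup>2) = (\<Sum>W\<in>F \<beta>. (cmod (v' \<beta>))\<^sup>2)"
        by (intro sum.cong refl) (simp add: F_def v')
      then show "(sqrt (card (F \<beta>)) * cmod (v' \<beta>))\<^sup>2 = (\<Sum>W\<in>F \<beta>. (cmod (v W))\<^sup>2)"
        by (simp add: power_mult_distrib)
    qed
    also have "\<dots> = (\<Sum>W\<in>L. (cmod (v W))\<^sup>2)" by (rule group[symmetric])
    finally show "(cmod (\<Sum>W\<in>L. \<omega> t ^ H W * v W))\<^sup>2
        \<le> real (card (\<tau> ` L) * D) * (\<Sum>W\<in>L. (cmod (v W))\<^sup>2)"
      by (rule order_trans) (intro mult_right_mono t sum_nonneg, simp)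
  qed
qed

text \<open>A multiset over \<open>A\<close> is determined by its multiplicities, each at most
  \<open>d\<close>. The crude count suffices, because in the application only its
  \<open>card A\<close>-th root matters.\<close>

lemma card_mset_le:
  assumes "finite A" and "\<And>M. M \<in> B \<Longrightarrow> set_mset M \<subseteq> A \<and> size M \<le> d"
  shows "card B \<le> (d + 1) ^ card A"
proof -
  let ?f = "\<lambda>M. restrict (count M) A"
  have inj: "inj_on ?f B"
  proof (rule inj_onI)
    fix M M' assume MM: "M \<in> B" "M' \<in> B" and eq: "?f M = ?f M'"
    show "M = M'"
    proof (rule multiset_eqI)
      fix x show "count M x = count M' x"
      proof (cases "x \<in> A")
        case True
        then show ?thesis using fun_cong[OF eq, of x] by simp
      next
        case False
        then have "x \<notin># M" "x \<notin># M'" using assms(2) MM by blast+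
        then show ?thesis by (simp add: not_in_iff)
      qed
    qed
  qed
  have "?f ` B \<subseteq> A \<rightarrow>\<^sub>E {..d}"
  proof -
    have "count M x \<le> d" if "M \<in> B" for M x
      using assms(2)[OF that] count_le_size[of M x] by linarith
    then show ?thesis by auto
  qed
  then have "card (?f ` B) \<le> card (A \<rightarrow>\<^sub>E {..d})"
    by (rule card_mono[rotated]) (simp add: finite_PiE assms)
  then show ?thesis using assms(1) by (simp add: card_image[OF inj] card_PiE)
qed

lemma prod_list_map_mult:
  "prod_list (map (\<lambda>x. f x * g x) xs) = prod_list (map f xs) * prod_list (map g xs :: 'a::comm_monoid_mult list)"
  by (induction xs) (auto simp: ac_simps)

lemma prod_list_map_concat:
  "prod_list (map f (concat W)) = (\<Prod>w\<leftarrow>W. prod_list (map f w :: 'a::monoid_mult list))"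
  by (induction W) auto

lemma prod_list_map_mset_cong:
  "mset w = mset w' \<Longrightarrow> prod_list (map f w) = prod_list (map f w' :: 'a::comm_monoid_mult list)"
  by (metis mset_map prod_mset_prod_list)

lemma norm_prod_list: "norm (prod_list xs :: 'a::real_normed_field) = prod_list (map norm xs)"
  by (induction xs) (auto simp: norm_mult)

lemma prod_list_map_power:
  "prod_list (map (\<lambda>x. f x ^ k) xs) = (prod_list (map f xs :: 'a::comm_monoid_mult list)) ^ k"
  by (induction xs) (auto simp: power_mult_distrib)

text \<open>The sum over words of type \<open>\<alpha>\<close> produces the multinomial coefficient \<open>m!/\<alpha>!\<close>.  The previous bound
  is applied to the expansion of the \<open>n\<close>-th power of the polynomial, which replaces the usual
  covering argument: the number of monomials enters only through its \<open>n\<close>-th root.\<close>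

lemma small_unimodular_polynomial:
  assumes n: "n \<ge> 1"
  obtains \<epsilon> :: "nat multiset \<Rightarrow> complex" where "\<And>\<alpha>. cmod (\<epsilon> \<alpha>) = 1"
    and "\<And>z. (cmod (\<Sum>w\<in>words {..<n} m. \<epsilon> (mset w) * prod_list (map z w)))\<^sup>2
      \<le> real n * fact m * real (m * n + 1) * (\<Sum>i<n. (cmod (z i))\<^sup>2) ^ m"
proof -
  let ?A = "words {..<n} m"
  let ?L = "words ?A n"
  have finA: "finite ?A" and finL: "finite ?L" by (simp_all add: finite_words)
  obtain h :: "nat multiset \<Rightarrow> nat" where h:
    "\<And>M M'. \<lbrakk>set_mset M \<subseteq> mset ` ?A; set_mset M' \<subseteq> mset ` ?A; size M \<le> n; size M' \<le> n;
       (\<Sum>x\<in>#M. h x) = (\<Sum>x\<in>#M'. h x)\<rbrakk> \<Longrightarrow> M = M'"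
    using sidon_weight[of "mset ` ?A" n] finA by blast
  \<comment> \<open>By the choice of \<open>h\<close>, the exponent \<open>H W\<close> determines
    the multiset of block types of \<open>W\<close>, so few lists of words share an
    exponent.\<close>
  define H where "H W = (\<Sum>w\<leftarrow>W. h (mset w))" for W
  define D where "D = (fact n * fact m ^ n :: nat)"
  have D: "card {W' \<in> ?L. H W' = H W} \<le> D" if W: "W \<in> ?L" for W
  proof -
    have "mset (map mset W') = mset (map mset W)" if W': "W' \<in> ?L" "H W' = H W" for W'
    proof (rule h)
      show "(\<Sum>x\<in>#mset (map mset W'). h x) = (\<Sum>x\<in>#mset (map mset W). h x)"
        using W'(2) by (simp add: H_def o_def image_mset.compositionality flip: sum_mset_sum_list)
    qed (use W W' in \<open>auto simp: words_def\<close>)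
    then have sub: "{W' \<in> ?L. H W' = H W} \<subseteq> {W'. mset (map mset W') = mset (map mset W)}" by blast
    have len: "\<forall>w\<in>set W. length w = m" using W by (auto simp: words_def)
    have "length W = n" using W by (auto simp: words_def)
    then show ?thesis
      using card_mono[OF card_same_block_types(1)[OF len] sub] card_same_block_types(2)[OF len]
      by (simp add: D_def)
  qed
  \<comment> \<open>The type of \<open>W\<close> is the monomial obtained by multiplying its blocks;
    for given \<open>z\<close>, the value \<open>?v W\<close> below depends on nothing else.\<close>
  let ?\<tau> = "\<lambda>W. mset (concat W)"
  obtain u where u: "cmod u = 1"
    and bound: "\<And>v :: nat list list \<Rightarrow> complex. (\<And>W W'. \<lbrakk>W \<in> ?L; W' \<in> ?L; ?\<tau> W = ?\<tau> W'\<rbrakk> \<Longrightarrow> v W = v W') \<Longrightarrow>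
      (cmod (\<Sum>W\<in>?L. u ^ H W * v W))\<^sup>2 \<le> real (card (?\<tau> ` ?L) * D) * (\<Sum>W\<in>?L. (cmod (v W))\<^sup>2)"
    using exists_phase[OF finL, where H = H and \<tau> = ?\<tau>, OF D] by blast
  have len: "length (concat W) = n * m" if "W \<in> ?L" for W
  proof -
    have "length (concat W) = (\<Sum>w\<leftarrow>W. m)"
      unfolding length_concat using that by (intro arg_cong[of _ _ sum_list] map_cong) (auto simp: words_def)
    then show ?thesis using that by (simp add: words_def sum_list_triv)
  qed
  have cardB: "card (?\<tau> ` ?L) \<le> (m * n + 1) ^ n"
  proof -
    have "set_mset M \<subseteq> {..<n} \<and> size M \<le> m * n" if "M \<in> ?\<tau> ` ?L" for M
    proof -
      from that obtain W where W: "W \<in> ?L" and M: "M = ?\<tau> W" by blast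
      have "set (concat W) \<subseteq> {..<n}" using W by (auto simp: words_def)
      then show ?thesis unfolding M set_mset_mset size_mset len[OF W] by simp
    qed
    then show ?thesis using card_mset_le[of "{..<n}" "?\<tau> ` ?L" "m * n"] by simp
  qed
  show ?thesis
  proof (rule that[of "\<lambda>\<alpha>. u ^ h \<alpha>"])
    show "cmod (u ^ h \<alpha>) = 1" for \<alpha> by (simp add: norm_power u)
  next
    fix z :: "nat \<Rightarrow> complex"
    let ?P = "\<Sum>w\<in>?A. u ^ h (mset w) * prod_list (map z w)"
    let ?v = "\<lambda>W. prod_list (map z (concat W))"
    let ?S = "\<Sum>i<n. (cmod (z i))\<^sup>2"
    \<comment> \<open>A term of the power is a product of \<open>n\<close> blocks, and its
      coefficient \<open>u ^ H W\<close> is again a power of the single phase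
      \<open>u\<close>.\<close>
    have "?P ^ n = (\<Sum>W\<in>?L. \<Prod>w\<leftarrow>W. u ^ h (mset w) * prod_list (map z w))"
      by (rule sum_words_prod_list[OF finA, symmetric])
    also have "\<dots> = (\<Sum>W\<in>?L. u ^ H W * ?v W)"
    proof (rule sum.cong[OF refl])
      fix W
      have "(\<Prod>w\<leftarrow>W. u ^ h (mset w)) = u ^ H W" unfolding H_def by (induction W) (auto simp: power_add)
      then show "(\<Prod>w\<leftarrow>W. u ^ h (mset w) * prod_list (map z w)) = u ^ H W * ?v W"
        by (simp add: prod_list_map_mult prod_list_map_concat)
    qed
    finally have P: "?P ^ n = (\<Sum>W\<in>?L. u ^ H W * ?v W)" .
    have "(\<Sum>W\<in>?L. (cmod (?v W))\<^sup>2) = (\<Sum>W\<in>?L. \<Prod>w\<leftarrow>W. prod_list (map (\<lambda>i. (cmod (z i))\<^sup>2) w))"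
      by (simp add: norm_prod_list prod_list_map_concat o_def flip: prod_list_map_power)
    also have "\<dots> = (\<Sum>w\<in>?A. prod_list (map (\<lambda>i. (cmod (z i))\<^sup>2) w)) ^ n"
      by (rule sum_words_prod_list[OF finA])
    also have "\<dots> = (?S ^ m) ^ n" by (simp add: sum_words_prod_list)
    finally have S: "(\<Sum>W\<in>?L. (cmod (?v W))\<^sup>2) = (?S ^ m) ^ n" .
    have S0: "?S \<ge> 0" by (simp add: sum_nonneg)
    have "((cmod ?P)\<^sup>2) ^ n = (cmod (?P ^ n))\<^sup>2"
      by (simp add: norm_power mult.commute flip: power_mult)
    also have "\<dots> \<le> real (card (?\<tau> ` ?L) * D) * (?S ^ m) ^ n"
      unfolding P S[symmetric] by (rule bound) (rule prod_list_map_mset_cong)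
    \<comment> \<open>Every factor is at most an \<open>n\<close>-th power: there are at most
      \<open>(m * n + 1) ^ n\<close> monomials, and \<open>fact n \<le> n ^ n\<close>. The
      \<open>n\<close>-th root leaves \<open>n\<close>, \<open>fact m\<close> and
      \<open>m * n + 1\<close>.\<close>
    also have "\<dots> \<le> (real n * fact m * real (m * n + 1)) ^ n * (?S ^ m) ^ n"
    proof (rule mult_right_mono)
      have "card (?\<tau> ` ?L) * D \<le> (m * n + 1) ^ n * (n ^ n * fact m ^ n)"
        unfolding D_def by (intro mult_le_mono cardB le_refl fact_le_power[of n, where 'a = nat, unfolded of_nat_id])
      then have "real (card (?\<tau> ` ?L) * D) \<le> real ((m * n + 1) ^ n * (n ^ n * fact m ^ n))"
        using of_nat_le_iff by blast
      then show "real (card (?\<tau> ` ?L) * D) \<le> (real n * fact m * real (m * n + 1)) ^ n"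
        by (simp add: power_mult_distrib mult_ac)
    qed (use S0 in simp)
    finally have "((cmod ?P)\<^sup>2) ^ n \<le> (real n * fact m * real (m * n + 1) * ?S ^ m) ^ n"
      by (simp only: power_mult_distrib)
    moreover have "x \<le> y" if "x ^ n \<le> y ^ n" "0 \<le> x" "0 \<le> y" for x y :: real
      using that n by simp
    moreover have "0 \<le> real n * fact m * real (m * n + 1) * ?S ^ m" using S0 by simp
    ultimately show "(cmod ?P)\<^sup>2 \<le> real n * fact m * real (m * n + 1) * ?S ^ m"
      using zero_le_power2 by blast
  qed
qed


section \<open>Upper bounds from the Bohr inequality\<close>

definition exponent_vec :: "nat \<Rightarrow> nat list \<Rightarrow> nat vec" where
  "exponent_vec n w = vec n (count_list w)"

lemma exponent_vec_carrier [simp]: "exponent_vec n w \<in> carrier_vec n"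
  by (simp add: exponent_vec_def)

lemma exponent_vec_eq_iff:
  assumes "w \<in> words {..<n} m" "w' \<in> words {..<n} m'"
  shows "exponent_vec n w = exponent_vec n w' \<longleftrightarrow> mset w = mset w'"
proof
  assume eq: "exponent_vec n w = exponent_vec n w'"
  show "mset w = mset w'"
  proof (rule multiset_eqI)
    fix i
    show "count (mset w) i = count (mset w') i"
    proof (cases "i < n")
      case True
      have "exponent_vec n w $ i = exponent_vec n w' $ i" using eq by simp
      with True show ?thesis by (simp add: exponent_vec_def count_mset)
    next
      case False
      then have "i \<notin> set w" "i \<notin> set w'" using assms by (auto simp: words_def)
      then show ?thesis by (simp add: count_mset)
    qed
  qed
next
  assume "mset w = mset w'"
  then show "exponent_vec n w = exponent_vec n w'"
    unfolding exponent_vec_def count_mset[symmetric, abs_def] by simp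
qed

lemma monomial_exponent_vec:
  assumes "w \<in> words {..<n} m"
  shows "monomial (exponent_vec n w) z = prod_list (map (\<lambda>i. z $ i) w)"
proof -
  have "set w \<subseteq> {..<n}" using assms by (simp add: words_def)
  then have "(\<Prod>i<n. z $ i ^ count_list w i) = prod_list (map (\<lambda>i. z $ i) w)"
  proof (induction w)
    case (Cons j w)
    have "(\<Prod>i<n. z $ i ^ count_list (j # w) i)
        = (\<Prod>i<n. (if i = j then z $ i else 1) * z $ i ^ count_list w i)"
      by (rule prod.cong) auto
    then show ?case using Cons by (simp add: prod.distrib)
  qed simp
  then show ?thesis by (simp add: monomial_def exponent_vec_def)
qed

lemma monomial_smult:
  assumes "\<alpha> \<in> carrier_vec n" "z \<in> carrier_vec n"
  shows "monomial \<alpha> (c \<cdot>\<^sub>v z) = c ^ (\<Sum>i<n. \<alpha> $ i) * monomial \<alpha> z"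
  using assms by (simp add: monomial_def power_mult_distrib prod.distrib power_sum)

section \<open>Analyticity of polynomials\<close>

definition open_Cn :: "nat \<Rightarrow> complex vec set \<Rightarrow> bool" where
  "open_Cn n \<Omega> \<longleftrightarrow> \<Omega> \<subseteq> carrier_vec n \<and>
     (\<forall>w\<in>\<Omega>. \<exists>\<epsilon>>0. \<forall>z\<in>carrier_vec n. (\<forall>i<n. cmod (z $ i - w $ i) < \<epsilon>) \<longrightarrow> z \<in> \<Omega>)"

text \<open>Convergence is demanded on the whole space, so that no radii have to be tracked while
  polynomials are built up; the neighbourhood inside \<Omega> comes separately from
  \<open>open_Cn\<close>.\<close>

definition power_series_at :: "nat \<Rightarrow> complex vec \<Rightarrow> (complex vec \<Rightarrow> complex) \<Rightarrow> bool" where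
  "power_series_at n w g \<longleftrightarrow> (\<exists>c. \<forall>z\<in>carrier_vec n.
     ((\<lambda>\<alpha>. monomial \<alpha> (z - w) * c \<alpha>) has_sum g z) (carrier_vec n))"

lemma power_series_at_const: "power_series_at n w (\<lambda>z. k)"
  unfolding power_series_at_def
proof (intro exI ballI)
  fix z :: "complex vec" assume "z \<in> carrier_vec n"
  show "((\<lambda>\<alpha>. monomial \<alpha> (z - w) * (if \<alpha> = 0\<^sub>v n then k else 0)) has_sum k) (carrier_vec n)"
    by (rule has_sum_finite_neutralI[of "{0\<^sub>v n}"]) (auto simp: monomial_def)
qed

lemma power_series_at_add:
  assumes "power_series_at n w f" "power_series_at n w g"
  shows "power_series_at n w (\<lambda>z. f z + g z)"
proof -
  from assms obtain c d where
    "\<forall>z\<in>carrier_vec n. ((\<lambda>\<alpha>. monomial \<alpha> (z - w) * c \<alpha>) has_sum f z) (carrier_vec n)"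
    "\<forall>z\<in>carrier_vec n. ((\<lambda>\<alpha>. monomial \<alpha> (z - w) * d \<alpha>) has_sum g z) (carrier_vec n)"
    unfolding power_series_at_def by blast
  then have "\<forall>z\<in>carrier_vec n.
      ((\<lambda>\<alpha>. monomial \<alpha> (z - w) * (c \<alpha> + d \<alpha>)) has_sum (f z + g z)) (carrier_vec n)"
    by (simp add: ring_distribs has_sum_add)
  then show ?thesis unfolding power_series_at_def by (intro exI[of _ "\<lambda>\<alpha>. c \<alpha> + d \<alpha>"])
qed

lemma power_series_at_cmult:
  assumes "power_series_at n w f"
  shows "power_series_at n w (\<lambda>z. k * f z)"
proof -
  from assms obtain c where
    "\<forall>z\<in>carrier_vec n. ((\<lambda>\<alpha>. monomial \<alpha> (z - w) * c \<alpha>) has_sum f z) (carrier_vec n)"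
    unfolding power_series_at_def by blast
  then have "\<forall>z\<in>carrier_vec n.
      ((\<lambda>\<alpha>. monomial \<alpha> (z - w) * (k * c \<alpha>)) has_sum (k * f z)) (carrier_vec n)"
    by (simp add: mult.left_commute[of _ k] has_sum_cmult_right)
  then show ?thesis unfolding power_series_at_def by (intro exI[of _ "\<lambda>\<alpha>. k * c \<alpha>"])
qed

text \<open>Multiplication by \<open>z $ i - w $ i\<close> raises the \<open>i\<close>-th exponent
  by one, so the coefficients are moved along the injection \<open>up\<close>.\<close>

lemma power_series_at_shift:
  assumes "power_series_at n w f" "i < n" "w \<in> carrier_vec n"
  shows "power_series_at n w (\<lambda>z. (z $ i - w $ i) * f z)"
proof -
  from assms obtain c where
    c: "\<forall>z\<in>carrier_vec n. ((\<lambda>\<alpha>. monomial \<alpha> (z - w) * c \<alpha>) has_sum f z) (carrier_vec n)"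
    unfolding power_series_at_def by blast
  define up where "up \<alpha> = vec n (\<lambda>j. \<alpha> $ j + (if j = i then 1 else 0 :: nat))" for \<alpha>
  define down where "down \<alpha> = vec n (\<lambda>j. \<alpha> $ j - (if j = i then 1 else 0 :: nat))" for \<alpha>
  have du: "down (up \<alpha>) = \<alpha>" if "\<alpha> \<in> carrier_vec n" for \<alpha>
    using that by (intro eq_vecI) (auto simp: up_def down_def)
  have inj: "inj_on up (carrier_vec n)" by (rule inj_on_inverseI[of _ down]) (rule du)
  \<comment> \<open>Multi-indices with \<open>i\<close>-th entry 0 lie outside the image of
    \<open>up\<close>. There the truncated subtraction in \<open>down\<close> does not invert
    \<open>up\<close>, and the coefficient has to be 0.\<close>
  define d where "d \<alpha> = (if \<alpha> \<in> up ` carrier_vec n then c (down \<alpha>) else 0)" for \<alpha>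
  have "((\<lambda>\<alpha>. monomial \<alpha> (z - w) * d \<alpha>) has_sum ((z $ i - w $ i) * f z)) (carrier_vec n)"
    if z: "z \<in> carrier_vec n" for z
  proof -
    have mon: "monomial (up \<alpha>) (z - w) = (z $ i - w $ i) * monomial \<alpha> (z - w)" if "\<alpha> \<in> carrier_vec n" for \<alpha>
    proof -
      have "monomial (up \<alpha>) (z - w) = (\<Prod>j<n. (if j = i then (z - w) $ j else 1) * (z - w) $ j ^ (\<alpha> $ j))"
        unfolding monomial_def by (rule prod.cong) (auto simp: up_def)
      also have "\<dots> = (z - w) $ i * monomial \<alpha> (z - w)"
        using that assms(2) by (simp add: prod.distrib monomial_def)
      finally show ?thesis using assms(2,3) by simp
    qed
    have "((\<lambda>\<alpha>. (z $ i - w $ i) * (monomial \<alpha> (z - w) * c \<alpha>)) has_sum ((z $ i - w $ i) * f z)) (carrier_vec n)"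
      by (rule has_sum_cmult_right) (use c z in blast)
    also have "?this \<longleftrightarrow> (((\<lambda>\<alpha>. monomial \<alpha> (z - w) * d \<alpha>) \<circ> up) has_sum ((z $ i - w $ i) * f z)) (carrier_vec n)"
      by (rule has_sum_cong) (simp add: mon d_def du mult.assoc)
    also have "\<dots> \<longleftrightarrow> ((\<lambda>\<alpha>. monomial \<alpha> (z - w) * d \<alpha>) has_sum ((z $ i - w $ i) * f z)) (up ` carrier_vec n)"
      by (rule has_sum_reindex[OF inj, symmetric])
    also have "\<dots> \<longleftrightarrow> ((\<lambda>\<alpha>. monomial \<alpha> (z - w) * d \<alpha>) has_sum ((z $ i - w $ i) * f z)) (carrier_vec n)"
      by (rule has_sum_cong_neutral) (auto simp: d_def up_def)
    finally show ?thesis .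
  qed
  then show ?thesis unfolding power_series_at_def by blast
qed

lemma power_series_at_coordinate:
  assumes "power_series_at n w f" "i < n" "w \<in> carrier_vec n"
  shows "power_series_at n w (\<lambda>z. z $ i * f z)"
  using power_series_at_add[OF power_series_at_shift[OF assms] power_series_at_cmult[OF assms(1), of "w $ i"]]
  by (simp add: algebra_simps)

lemma power_series_at_word:
  assumes "set v \<subseteq> {..<n}" "w \<in> carrier_vec n"
  shows "power_series_at n w (\<lambda>z. prod_list (map (\<lambda>i. z $ i) v))"
  using assms(1)
proof (induction v)
  case Nil
  then show ?case by (simp add: power_series_at_const)
next
  case (Cons i v)
  then show ?case using power_series_at_coordinate[of n w _ i] assms(2) by simp
qed

lemma power_series_at_sum:
  assumes "finite A" "\<And>a. a \<in> A \<Longrightarrow> power_series_at n w (f a)"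
  shows "power_series_at n w (\<lambda>z. \<Sum>a\<in>A. f a z)"
  using assms by (induction A) (auto intro: power_series_at_const power_series_at_add)

text \<open>Carries scalar expansions over to vector-valued ones; real linearity and boundedness are
  enough for this.\<close>

lemma bounded_linear_scaleC_left: "bounded_linear (\<lambda>c. c *\<^sub>C (x::'x::complex_banach))"
proof (rule bounded_linear_intro)
  show "(r *\<^sub>R c) *\<^sub>C x = r *\<^sub>R (c *\<^sub>C x)" for r c
    by (simp add: scaleR_conv_of_real flip: scaleC_of_real scaleC_scaleC)
  show "norm (c *\<^sub>C x) \<le> norm c * norm x" for c
    by (simp add: norm_scaleC)
qed (rule scaleC_add_left)

lemma analytic_Cn_scaleC:
  fixes x :: "'x::complex_banach"
  assumes "open_Cn n \<Omega>" "\<And>w. w \<in> carrier_vec n \<Longrightarrow> power_series_at n w g"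
  shows "analytic_Cn n \<Omega> (\<lambda>z. g z *\<^sub>C x)"
  unfolding analytic_Cn_def
proof
  fix w assume w: "w \<in> \<Omega>"
  then have "w \<in> carrier_vec n" using assms(1) by (auto simp: open_Cn_def)
  then obtain c where
    c: "\<And>z. z \<in> carrier_vec n \<Longrightarrow> ((\<lambda>\<alpha>. monomial \<alpha> (z - w) * c \<alpha>) has_sum g z) (carrier_vec n)"
    using assms(2)[of w] unfolding power_series_at_def by blast
  have "((\<lambda>\<alpha>. monomial \<alpha> (z - w) *\<^sub>C (c \<alpha> *\<^sub>C x)) has_sum (g z *\<^sub>C x)) (carrier_vec n)"
    if "z \<in> carrier_vec n" for z
    using has_sum_bounded_linear[OF bounded_linear_scaleC_left c[OF that], of x]
    by (simp add: scaleC_scaleC)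
  moreover obtain \<epsilon> where "\<epsilon> > 0" "\<forall>z\<in>carrier_vec n. (\<forall>i<n. cmod (z $ i - w $ i) < \<epsilon>) \<longrightarrow> z \<in> \<Omega>"
    using assms(1) w unfolding open_Cn_def by blast
  ultimately show "\<exists>\<epsilon>>0. \<exists>c. \<forall>z\<in>carrier_vec n.
     (\<forall>i<n. cmod (z $ i - w $ i) < \<epsilon>) \<longrightarrow>
       z \<in> \<Omega> \<and> ((\<lambda>\<alpha>. monomial \<alpha> (z - w) *\<^sub>C c \<alpha>) has_sum g z *\<^sub>C x) (carrier_vec n)"
    by (intro exI[of _ \<epsilon>] conjI exI[of _ "\<lambda>\<alpha>. c \<alpha> *\<^sub>C x"]) auto
qed

section \<open>The Bohr inequality tested on a unimodular polynomial\<close>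

lemma infsum_ennreal_ge_finite_sum:
  fixes f :: "'a \<Rightarrow> ennreal"
  assumes "finite F" "F \<subseteq> A"
  shows "sum f F \<le> infsum f A"
proof -
  have "infsum f F \<le> infsum f A" 
    by (rule infsum_mono_neutral) (use assms in \<open>auto intro: nonneg_summable_on_complete\<close>)
  then show ?thesis using assms by simp
qed

text \<open>The test function is \<open>g z *\<^sub>C x\<close>, with \<open>g\<close> the
  polynomial of \<open>small_unimodular_polynomial\<close> in the variables
  \<open>s i * z $ i\<close>. Its supremum over \<Omega> is small by \<open>bound\<close>, while the
  Bohr sum sees only moduli of coefficients and, at \<open>r\<close> times \<open>u\<close>,
  recovers the \<open>m\<close>-th power of the weighted sum.\<close>

lemma bohr_inequality_upper:
  fixes x :: "'x::complex_banach"
  assumes n: "n \<ge> 1" and x: "x \<noteq> 0" and op: "open_Cn n \<Omega>" and lam: "lam \<ge> 0" and A: "A \<ge> 0"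
    and bohr: "bohr_inequality n \<Omega> (id :: 'x \<Rightarrow> 'x) lam r" and r: "r \<ge> 0"
    and s: "\<And>i. i < n \<Longrightarrow> s i \<ge> 0"
    and bound: "\<And>z. z \<in> \<Omega> \<Longrightarrow> (\<Sum>i<n. (s i * cmod (z $ i))\<^sup>2) \<le> A\<^sup>2"
    and u: "u \<in> \<Omega>"
  shows "(r * (\<Sum>i<n. s i * cmod (u $ i))) ^ m
    \<le> lam * sqrt (real n * fact m * real (m * n + 1)) * A ^ m"
proof -
  let ?W = "words {..<n} m"
  let ?K = "real n * fact m * real (m * n + 1)"
  obtain \<epsilon> :: "nat multiset \<Rightarrow> complex" where e1: "\<And>\<alpha>. cmod (\<epsilon> \<alpha>) = 1"
    and e2: "\<And>z. (cmod (\<Sum>w\<in>?W. \<epsilon> (mset w) * prod_list (map z w)))\<^sup>2 \<le> ?K * (\<Sum>i<n. (cmod (z i))\<^sup>2) ^ m"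
    using small_unimodular_polynomial[OF n, of m] by blast
  define \<sigma> where "\<sigma> w = complex_of_real (prod_list (map s w))" for w
  define g where "g z = (\<Sum>w\<in>?W. (\<epsilon> (mset w) * \<sigma> w) * prod_list (map (\<lambda>i. z $ i) w))" for z :: "complex vec"
  define F where "F \<alpha> = {w \<in> ?W. exponent_vec n w = \<alpha>}" for \<alpha>
  \<comment> \<open>Collecting the words with exponent \<alpha> gives \<epsilon> times a multinomial
    coefficient times a monomial in the weights; outside \<open>?E\<close> there are no such
    words.\<close>
  define a where "a \<alpha> = (\<Sum>w\<in>F \<alpha>. \<epsilon> (mset w) * \<sigma> w) *\<^sub>C x" for \<alpha>
  let ?E = "exponent_vec n ` ?W"
  have finW: "finite ?W" by (simp add: finite_words)
  have \<Omega>c: "\<Omega> \<subseteq> carrier_vec n" using op by (simp add: open_Cn_def)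
  have \<sigma>_mult: "\<sigma> w * prod_list (map f w) = prod_list (map (\<lambda>i. complex_of_real (s i) * f i) w)" for w f
    unfolding \<sigma>_def by (induction w) auto
  have group: "(\<Sum>w\<in>?W. h w) = (\<Sum>\<alpha>\<in>?E. \<Sum>w\<in>F \<alpha>. h w)" for h :: "nat list \<Rightarrow> 'c::comm_monoid_add"
    unfolding F_def by (rule sum.image_gen[OF finW])
  have ga: "(\<Sum>\<alpha>\<in>?E. monomial \<alpha> z *\<^sub>C a \<alpha>) = g z *\<^sub>C x" for z
  proof -
    interpret bounded_linear "\<lambda>c. c *\<^sub>C x" by (rule bounded_linear_scaleC_left)
    have "g z = (\<Sum>\<alpha>\<in>?E. monomial \<alpha> z * (\<Sum>w\<in>F \<alpha>. \<epsilon> (mset w) * \<sigma> w))"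
      unfolding g_def group sum_distrib_left
      by (intro sum.cong refl) (auto simp: F_def monomial_exponent_vec[symmetric])
    then have "g z *\<^sub>C x = (\<Sum>\<alpha>\<in>?E. (monomial \<alpha> z * (\<Sum>w\<in>F \<alpha>. \<epsilon> (mset w) * \<sigma> w)) *\<^sub>C x)"
      by (simp only: sum)
    then show ?thesis by (simp only: a_def scaleC_scaleC)
  qed
  have "analytic_Cn n \<Omega> (\<lambda>z. g z *\<^sub>C x)"
    unfolding g_def
    by (intro analytic_Cn_scaleC op power_series_at_sum finW power_series_at_cmult power_series_at_word)
      (auto simp: words_def)
  moreover have "monomial_expansion n \<Omega> (\<lambda>z. g z *\<^sub>C x) a"
    unfolding monomial_expansion_def
  proof
    fix z
    have "a \<alpha> = 0" if "\<alpha> \<notin> ?E" for \<alpha>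
    proof -
      have "F \<alpha> = {}" using that by (auto simp: F_def)
      then show ?thesis using norm_scaleC[of 0 x] by (simp add: a_def)
    qed
    moreover have "c *\<^sub>C (0::'x) = 0" for c using norm_scaleC[of c "0::'x"] by simp
    ultimately show "((\<lambda>\<alpha>. monomial \<alpha> z *\<^sub>C a \<alpha>) has_sum g z *\<^sub>C x) (carrier_vec n)"
      by (intro has_sum_finite_neutralI[of ?E]) (auto simp: finW ga)
  qed
  ultimately have le: "(\<Sum>\<^sub>\<infinity>\<alpha>\<in>carrier_vec n.
        (SUP z\<in>(\<lambda>z. complex_of_real r \<cdot>\<^sub>v z) ` \<Omega>. ennreal (norm (monomial \<alpha> z *\<^sub>C a \<alpha>))))
       \<le> ennreal lam * (SUP z\<in>\<Omega>. ennreal (norm (g z *\<^sub>C x)))"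
    using bohr unfolding bohr_inequality_def by simp
  have gbound: "cmod (g z) \<le> sqrt ?K * A ^ m" if "z \<in> \<Omega>" for z
  proof -
    have "g z = (\<Sum>w\<in>?W. \<epsilon> (mset w) * prod_list (map (\<lambda>i. complex_of_real (s i) * z $ i) w))"
      unfolding g_def by (simp add: \<sigma>_mult mult.assoc)
    then have "(cmod (g z))\<^sup>2 \<le> ?K * (\<Sum>i<n. (cmod (complex_of_real (s i) * z $ i))\<^sup>2) ^ m"
      using e2 by simp
    also have "(\<Sum>i<n. (cmod (complex_of_real (s i) * z $ i))\<^sup>2) = (\<Sum>i<n. (s i * cmod (z $ i))\<^sup>2)"
      by (simp add: norm_mult power_mult_distrib)
    also have "?K * (\<Sum>i<n. (s i * cmod (z $ i))\<^sup>2) ^ m \<le> ?K * (A\<^sup>2) ^ m"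
      by (intro mult_left_mono power_mono bound that sum_nonneg) auto
    also have "\<dots> = (sqrt ?K * A ^ m)\<^sup>2"
      by (simp add: power_mult_distrib real_sqrt_pow2 mult.commute flip: power_mult)
    finally show ?thesis by (rule power2_le_imp_le) (use A in simp)
  qed
  have "(SUP z\<in>\<Omega>. ennreal (norm (g z *\<^sub>C x))) \<le> ennreal (sqrt ?K * A ^ m * norm x)"
    unfolding norm_scaleC by (intro SUP_least ennreal_leI mult_right_mono gbound norm_ge_zero)
  then have "ennreal lam * (SUP z\<in>\<Omega>. ennreal (norm (g z *\<^sub>C x)))
      \<le> ennreal lam * ennreal (sqrt ?K * A ^ m * norm x)"
    by (rule mult_left_mono) simp
  also have "\<dots> = ennreal (lam * (sqrt ?K * A ^ m * norm x))"
    using lam A by (intro ennreal_mult[symmetric]) auto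
  finally have rhs: "ennreal lam * (SUP z\<in>\<Omega>. ennreal (norm (g z *\<^sub>C x))) \<le> ennreal (lam * (sqrt ?K * A ^ m * norm x))" .
  let ?ru = "complex_of_real r \<cdot>\<^sub>v u"
  have ru: "?ru $ i = complex_of_real r * u $ i" if "i < n" for i
    using that u \<Omega>c by auto
  \<comment> \<open>The words of one exponent vector share \<epsilon> and \<sigma>, so nothing
    cancels within a coefficient.\<close>
  have term_eq: "norm (monomial \<alpha> ?ru *\<^sub>C a \<alpha>)
      = (\<Sum>w\<in>F \<alpha>. prod_list (map (\<lambda>i. r * (s i * cmod (u $ i))) w)) * norm x" if \<alpha>: "\<alpha> \<in> ?E" for \<alpha>
  proof -
    from \<alpha> obtain w0 where w0: "w0 \<in> ?W" "\<alpha> = exponent_vec n w0" by blast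
    have ms: "mset w = mset w0" if "w \<in> F \<alpha>" for w
      using that w0 exponent_vec_eq_iff[of w n m w0 m] by (simp add: F_def)
    let ?p = "\<lambda>w. prod_list (map (\<lambda>i. r * (s i * cmod (u $ i))) w)"
    have p0: "?p w0 = cmod (\<sigma> w0 * monomial \<alpha> ?ru)"
    proof -
      have "\<sigma> w0 * monomial \<alpha> ?ru = prod_list (map (\<lambda>i. complex_of_real (s i) * ?ru $ i) w0)"
        using w0 by (simp add: monomial_exponent_vec \<sigma>_mult)
      also have "\<dots> = prod_list (map (\<lambda>i. complex_of_real (s i) * (complex_of_real r * u $ i)) w0)"
        using w0 by (intro arg_cong[of _ _ prod_list] map_cong) (auto simp: words_def ru)
      also have "cmod \<dots> = ?p w0"
        unfolding norm_prod_list map_map using w0 r s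
        by (intro arg_cong[of _ _ prod_list] map_cong) (auto simp: words_def norm_mult)
      finally show ?thesis by simp
    qed
    have "(\<Sum>w\<in>F \<alpha>. \<epsilon> (mset w) * \<sigma> w) = (\<Sum>w\<in>F \<alpha>. \<epsilon> (mset w0) * \<sigma> w0)"
      unfolding \<sigma>_def using ms by (intro sum.cong refl) (metis prod_list_map_mset_cong)
    then have "norm (monomial \<alpha> ?ru *\<^sub>C a \<alpha>) = card (F \<alpha>) * ?p w0 * norm x"
      by (simp add: a_def norm_scaleC norm_mult e1 p0)
    also have "card (F \<alpha>) * ?p w0 = (\<Sum>w\<in>F \<alpha>. ?p w0)" by simp
    also have "\<dots> = (\<Sum>w\<in>F \<alpha>. ?p w)"
      using ms by (intro sum.cong refl prod_list_map_mset_cong) simp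
    finally show ?thesis .
  qed
  have "(r * (\<Sum>i<n. s i * cmod (u $ i))) ^ m * norm x
      = (\<Sum>w\<in>?W. prod_list (map (\<lambda>i. r * (s i * cmod (u $ i))) w)) * norm x"
    by (simp add: sum_words_prod_list sum_distrib_left)
  also have "\<dots> = (\<Sum>\<alpha>\<in>?E. norm (monomial \<alpha> ?ru *\<^sub>C a \<alpha>))"
    unfolding group sum_distrib_right[of _ ?E] by (intro sum.cong refl) (simp add: term_eq)
  finally have "ennreal ((r * (\<Sum>i<n. s i * cmod (u $ i))) ^ m * norm x)
      = (\<Sum>\<alpha>\<in>?E. ennreal (norm (monomial \<alpha> ?ru *\<^sub>C a \<alpha>)))" by (simp add: sum_ennreal)
  \<comment> \<open>The single point \<open>?ru\<close> bounds all the suprema from below at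
    once.\<close>
  also have "\<dots> \<le> (\<Sum>\<alpha>\<in>?E. SUP z\<in>(\<lambda>z. complex_of_real r \<cdot>\<^sub>v z) ` \<Omega>. ennreal (norm (monomial \<alpha> z *\<^sub>C a \<alpha>)))"
    using u by (intro sum_mono SUP_upper) auto
  also have "\<dots> \<le> (\<Sum>\<^sub>\<infinity>\<alpha>\<in>carrier_vec n.
        (SUP z\<in>(\<lambda>z. complex_of_real r \<cdot>\<^sub>v z) ` \<Omega>. ennreal (norm (monomial \<alpha> z *\<^sub>C a \<alpha>))))"
    by (rule infsum_ennreal_ge_finite_sum) (use finW in auto)
  also note le
  also note rhs
  finally have "(r * (\<Sum>i<n. s i * cmod (u $ i))) ^ m * norm x \<le> lam * (sqrt ?K * A ^ m * norm x)"
    using lam A by (subst (asm) ennreal_le_iff) auto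
  then show ?thesis using x by (simp add: mult.assoc flip: mult_le_cancel_right)
qed


section \<open>Existence of the second Bohr radius\<close>

definition bohr_term ::
    "complex vec set \<Rightarrow> (nat vec \<Rightarrow> 'x::complex_banach) \<Rightarrow> real \<Rightarrow> nat vec \<Rightarrow> ennreal" where
  "bohr_term \<Omega> a r \<alpha> =
     (SUP z\<in>(\<lambda>z. complex_of_real r \<cdot>\<^sub>v z) ` \<Omega>. ennreal (norm (monomial \<alpha> z *\<^sub>C a \<alpha>)))"

lemma bohr_inequality_id_iff:
  "bohr_inequality n \<Omega> (id :: 'x::complex_banach \<Rightarrow> 'x) lam r \<longleftrightarrow>
     (\<forall>(f :: complex vec \<Rightarrow> 'x) a. analytic_Cn n \<Omega> f \<and> monomial_expansion n \<Omega> f a \<longrightarrow>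
     (\<Sum>\<^sub>\<infinity>\<alpha>\<in>carrier_vec n. bohr_term \<Omega> a r \<alpha>) \<le> ennreal lam * (SUP z\<in>\<Omega>. ennreal (norm (f z))))"
  by (simp add: bohr_inequality_def bohr_term_def)

text \<open>Homogeneity of the monomial. Both facts about the set of admissible radii, that it is an
  interval and that it is closed, rest on this factor.\<close>

lemma bohr_term_scale:
  assumes "\<Omega> \<subseteq> carrier_vec n" "\<alpha> \<in> carrier_vec n" "q \<ge> 0"
  shows "bohr_term \<Omega> a (q * r) \<alpha> = ennreal (q ^ (\<Sum>i<n. \<alpha> $ i)) * bohr_term \<Omega> a r \<alpha>"
proof -
  have "norm (monomial \<alpha> (complex_of_real (q * r) \<cdot>\<^sub>v z) *\<^sub>C a \<alpha>)
      = q ^ (\<Sum>i<n. \<alpha> $ i) * norm (monomial \<alpha> (complex_of_real r \<cdot>\<^sub>v z) *\<^sub>C a \<alpha>)" if "z \<in> \<Omega>" for z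
  proof -
    have "z \<in> carrier_vec n" using that assms by blast
    then show ?thesis using assms
      by (simp add: monomial_smult norm_scaleC norm_mult norm_power power_mult_distrib)
  qed
  then show ?thesis
    unfolding bohr_term_def SUP_mult_left_ennreal image_image
    using assms(3) by (intro SUP_cong refl) (simp add: ennreal_mult)
qed

lemma bohr_inequality_mono:
  assumes "\<Omega> \<subseteq> carrier_vec n" "bohr_inequality n \<Omega> (id :: 'x::complex_banach \<Rightarrow> 'x) lam r" "0 \<le> q" "q \<le> 1"
  shows "bohr_inequality n \<Omega> (id :: 'x \<Rightarrow> 'x) lam (q * r)"
  unfolding bohr_inequality_id_iff
proof (intro allI impI)
  fix f :: "complex vec \<Rightarrow> 'x" and a assume fa: "analytic_Cn n \<Omega> f \<and> monomial_expansion n \<Omega> f a"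
  have "(\<Sum>\<^sub>\<infinity>\<alpha>\<in>carrier_vec n. bohr_term \<Omega> a (q * r) \<alpha>) \<le> (\<Sum>\<^sub>\<infinity>\<alpha>\<in>carrier_vec n. bohr_term \<Omega> a r \<alpha>)"
  proof (rule infsum_mono)
    fix \<alpha> :: "nat vec" assume \<alpha>: "\<alpha> \<in> carrier_vec n"
    have "bohr_term \<Omega> a (q * r) \<alpha> \<le> 1 * bohr_term \<Omega> a r \<alpha>"
      unfolding bohr_term_scale[OF assms(1) \<alpha> assms(3)]
      by (rule mult_right_mono) (use assms in \<open>auto intro: power_le_one\<close>)
    then show "bohr_term \<Omega> a (q * r) \<alpha> \<le> bohr_term \<Omega> a r \<alpha>" by simp
  qed (auto intro: nonneg_summable_on_complete)
  also have "\<dots> \<le> ennreal lam * (SUP z\<in>\<Omega>. ennreal (norm (f z)))"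
    using assms(2) fa unfolding bohr_inequality_id_iff by blast
  finally show "(\<Sum>\<^sub>\<infinity>\<alpha>\<in>carrier_vec n. bohr_term \<Omega> a (q * r) \<alpha>) \<le> ennreal lam * (SUP z\<in>\<Omega>. ennreal (norm (f z)))" .
qed

lemma ennreal_le_mult_one_interval:
  assumes "\<And>p. \<lbrakk>0 < p; p < 1\<rbrakk> \<Longrightarrow> ennreal p * x \<le> y"
  shows "x \<le> y"
proof (cases y)
  case (real b)
  show ?thesis
  proof (cases x)
    case (real a)
    have "p * a \<le> b" if "0 < p" "p < 1" for p
    proof -
      have "ennreal (p * a) \<le> ennreal b"
        using assms[OF that] \<open>y = ennreal b\<close> \<open>x = ennreal a\<close> that \<open>0 \<le> a\<close> by (simp add: ennreal_mult)
      then show ?thesis using \<open>0 \<le> b\<close> by (simp add: ennreal_le_iff)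
    qed
    then have "a \<le> b" by (rule field_le_mult_one_interval)
    then show ?thesis using \<open>y = ennreal b\<close> \<open>x = ennreal a\<close> by (simp add: ennreal_leI)
  next
    case top
    then show ?thesis using assms[of "1/2"] real by (simp add: ennreal_mult_top top_unique)
  qed
qed simp

text \<open>The set of admissible radii is closed at its right end. It is enough to test finite
  partial sums; in these the degrees are bounded, so the factors \<open>q ^ deg \<alpha>\<close>
  tend to 1 uniformly as \<open>q\<close> tends to 1.\<close>

lemma bohr_inequality_limit:
  assumes sub: "\<Omega> \<subseteq> carrier_vec n" and R: "R \<ge> 0"
    and q: "\<And>q. \<lbrakk>0 < q; q < 1\<rbrakk> \<Longrightarrow> bohr_inequality n \<Omega> (id :: 'x::complex_banach \<Rightarrow> 'x) lam (q * R)"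
  shows "bohr_inequality n \<Omega> (id :: 'x \<Rightarrow> 'x) lam R"
  unfolding bohr_inequality_id_iff
proof (intro allI impI)
  fix f :: "complex vec \<Rightarrow> 'x" and a assume fa: "analytic_Cn n \<Omega> f \<and> monomial_expansion n \<Omega> f a"
  let ?rhs = "ennreal lam * (SUP z\<in>\<Omega>. ennreal (norm (f z)))"
  show "(\<Sum>\<^sub>\<infinity>\<alpha>\<in>carrier_vec n. bohr_term \<Omega> a R \<alpha>) \<le> ?rhs"
  proof (rule infsum_le_finite_sums)
    fix F :: "nat vec set" assume F: "finite F" "F \<subseteq> carrier_vec n"
    define deg where "deg \<alpha> = (\<Sum>i<n. \<alpha> $ i)" for \<alpha> :: "nat vec"
    \<comment> \<open>The sum of the degrees is a crude common bound for all of them.\<close>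
    define d where "d = (\<Sum>\<alpha>\<in>F. deg \<alpha>)"
    have dd: "deg \<alpha> \<le> d" if "\<alpha> \<in> F" for \<alpha> unfolding d_def using F that by (intro member_le_sum) auto
    show "(\<Sum>\<alpha>\<in>F. bohr_term \<Omega> a R \<alpha>) \<le> ?rhs"
    proof (rule ennreal_le_mult_one_interval)
      fix p :: real assume p: "0 < p" "p < 1"
      \<comment> \<open>Chosen so that Bernoulli's inequality gives
        \<open>(1 - t) ^ d \<ge> 1 - d * t \<ge> p\<close>. The \<open>+ 1\<close> covers
        \<open>d = 0\<close> and gives \<open>t \<le> 1 - p\<close>, hence
        \<open>q > 0\<close>.\<close>
      define t where "t = (1 - p) / (real d + 1)"
      define q where "q = 1 - t"
      have t: "0 < t" "t \<le> 1 - p" "real d * t \<le> 1 - p"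
        using p mult_right_mono[of 1 "real d + 1" "1 - p"] mult_right_mono[of "real d" "real d + 1" "1 - p"]
        by (auto simp: t_def field_simps)
      have q: "0 < q" "q < 1" using t p by (auto simp: q_def)
      have "1 + real d * (- t) \<le> (1 + (- t)) ^ d" by (rule Bernoulli_inequality) (use t p in auto)
      then have pq: "p \<le> q ^ d" using t by (simp add: q_def)
      have "ennreal p * (\<Sum>\<alpha>\<in>F. bohr_term \<Omega> a R \<alpha>) = (\<Sum>\<alpha>\<in>F. ennreal p * bohr_term \<Omega> a R \<alpha>)"
        by (rule sum_distrib_left)
      also have "\<dots> \<le> (\<Sum>\<alpha>\<in>F. bohr_term \<Omega> a (q * R) \<alpha>)"
      proof (rule sum_mono)
        fix \<alpha> assume \<alpha>: "\<alpha> \<in> F"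
        have "p \<le> q ^ deg \<alpha>"
          using order_trans[OF pq power_decreasing[OF dd[OF \<alpha>]]] q by auto
        then have "ennreal p * bohr_term \<Omega> a R \<alpha> \<le> ennreal (q ^ deg \<alpha>) * bohr_term \<Omega> a R \<alpha>"
          by (intro mult_right_mono ennreal_leI) auto
        then show "ennreal p * bohr_term \<Omega> a R \<alpha> \<le> bohr_term \<Omega> a (q * R) \<alpha>"
          using bohr_term_scale[OF sub, of \<alpha> q a R] \<alpha> F q by (auto simp: deg_def)
      qed
      also have "\<dots> \<le> (\<Sum>\<^sub>\<infinity>\<alpha>\<in>carrier_vec n. bohr_term \<Omega> a (q * R) \<alpha>)"
        by (rule infsum_ennreal_ge_finite_sum[OF F])
      also have "\<dots> \<le> ?rhs"
        using assms(3)[OF q] fa unfolding bohr_inequality_id_iff by blast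
      finally show "ennreal p * (\<Sum>\<alpha>\<in>F. bohr_term \<Omega> a R \<alpha>) \<le> ?rhs" .
    qed
  qed (auto intro: nonneg_summable_on_complete)
qed

text \<open>At radius 0 only the constant term survives; it equals the value of \<open>f\<close> at
  the origin, and \<open>lam \<ge> 1\<close> does the rest.\<close>

lemma bohr_inequality_zero:
  assumes "\<Omega> \<subseteq> carrier_vec n" "0\<^sub>v n \<in> \<Omega>" "lam \<ge> 1"
  shows "bohr_inequality n \<Omega> (id :: 'x::complex_banach \<Rightarrow> 'x) lam 0"
  unfolding bohr_inequality_id_iff
proof (intro allI impI)
  fix f :: "complex vec \<Rightarrow> 'x" and a assume fa: "analytic_Cn n \<Omega> f \<and> monomial_expansion n \<Omega> f a"
  have z0: "complex_of_real 0 \<cdot>\<^sub>v z = 0\<^sub>v n" if "z \<in> \<Omega>" for z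
    using that assms by (intro eq_vecI) auto
  have img: "(\<lambda>z. complex_of_real 0 \<cdot>\<^sub>v z) ` \<Omega> = {0\<^sub>v n}"
    using z0 assms(2) by force
  have term0: "bohr_term \<Omega> a 0 \<alpha> = ennreal (norm (monomial \<alpha> (0\<^sub>v n) *\<^sub>C a \<alpha>))" for \<alpha>
    unfolding bohr_term_def img by simp
  have mon0: "monomial \<alpha> (0\<^sub>v n) = 0" if "\<alpha> \<in> carrier_vec n - {0\<^sub>v n}" for \<alpha>
  proof -
    have "\<exists>i<n. \<alpha> $ i \<noteq> 0"
    proof (rule ccontr)
      assume "\<not> ?thesis"
      then have "\<alpha> = 0\<^sub>v n" using that by (intro eq_vecI) auto
      then show False using that by blast
    qed
    then show ?thesis using that by (auto simp: monomial_def intro!: prod_zero)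
  qed
  have zero_scale: "0 *\<^sub>C x = 0" for x :: 'x using norm_scaleC[of 0 x] by simp
  have one_scale: "1 *\<^sub>C x = x" for x :: 'x using scaleC_of_real[of 1 x] by simp
  have mon1: "monomial (0\<^sub>v n) (0\<^sub>v n) = 1" by (simp add: monomial_def)
  have "((\<lambda>\<alpha>. bohr_term \<Omega> a 0 \<alpha>) has_sum ennreal (norm (a (0\<^sub>v n)))) (carrier_vec n)"
    by (rule has_sum_finite_neutralI[of "{0\<^sub>v n}"]) (auto simp: term0 mon0 zero_scale mon1 one_scale)
  then have "(\<Sum>\<^sub>\<infinity>\<alpha>\<in>carrier_vec n. bohr_term \<Omega> a 0 \<alpha>) = ennreal (norm (a (0\<^sub>v n)))"
    by (rule infsumI)
  also have "a (0\<^sub>v n) = f (0\<^sub>v n)"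
  proof -
    have "((\<lambda>\<alpha>. monomial \<alpha> (0\<^sub>v n) *\<^sub>C a \<alpha>) has_sum a (0\<^sub>v n)) (carrier_vec n)"
      by (rule has_sum_finite_neutralI[of "{0\<^sub>v n}"]) (auto simp: mon0 zero_scale mon1 one_scale)
    moreover have "((\<lambda>\<alpha>. monomial \<alpha> (0\<^sub>v n) *\<^sub>C a \<alpha>) has_sum f (0\<^sub>v n)) (carrier_vec n)"
      using fa assms(2) unfolding monomial_expansion_def by blast
    ultimately show ?thesis by (rule has_sum_unique)
  qed
  also have "ennreal (norm (f (0\<^sub>v n))) \<le> (SUP z\<in>\<Omega>. ennreal (norm (f z)))"
    by (rule SUP_upper[OF assms(2)])
  also have "\<dots> \<le> ennreal lam * (SUP z\<in>\<Omega>. ennreal (norm (f z)))"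
    using mult_right_mono[of 1 "ennreal lam"] assms(3) by simp
  finally show "(\<Sum>\<^sub>\<infinity>\<alpha>\<in>carrier_vec n. bohr_term \<Omega> a 0 \<alpha>) \<le> ennreal lam * (SUP z\<in>\<Omega>. ennreal (norm (f z)))" .
qed

text \<open>\<open>GREATEST\<close> says something only if a greatest admissible radius exists. The
  set contains 0, is bounded by \<open>bohr_inequality_upper\<close>, and contains its supremum by
  \<open>bohr_inequality_limit\<close>.\<close>

lemma second_bohr_radius_space_admissible:
  fixes X :: "'x::complex_banach itself" and x :: 'x
  assumes n: "n \<ge> 1" and x: "x \<noteq> 0" and op: "open_Cn n \<Omega>" and zero: "0\<^sub>v n \<in> \<Omega>"
    and C: "\<And>z i. \<lbrakk>z \<in> \<Omega>; i < n\<rbrakk> \<Longrightarrow> cmod (z $ i) \<le> C" and lam: "lam \<ge> 1"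
  shows "0 \<le> second_bohr_radius_space n \<Omega> X lam"
    and "bohr_inequality n \<Omega> (id :: 'x \<Rightarrow> 'x) lam (second_bohr_radius_space n \<Omega> X lam)"
proof -
  let ?P = "\<lambda>r. 0 \<le> r \<and> bohr_inequality n \<Omega> (id :: 'x \<Rightarrow> 'x) lam r"
  have sub: "\<Omega> \<subseteq> carrier_vec n" using op by (simp add: open_Cn_def)
  have P0: "?P 0" using bohr_inequality_zero[OF sub zero lam] by simp
  have C0: "C \<ge> 0" using C[OF zero, of 0] n by simp
  obtain e where e: "e > 0" "\<And>z. \<lbrakk>z \<in> carrier_vec n; \<forall>i<n. cmod (z $ i - 0\<^sub>v n $ i) < e\<rbrakk> \<Longrightarrow> z \<in> \<Omega>"
    using op zero unfolding open_Cn_def by meson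
  \<comment> \<open>A point of \<Omega> with positive coordinate sum, so that the estimate for
    \<open>r\<close> can be solved.\<close>
  define u where "u = vec n (\<lambda>_. complex_of_real (e / 2))"
  have u: "u \<in> \<Omega>" by (rule e) (use e(1) in \<open>auto simp: u_def\<close>)
  define A where "A = sqrt (real n * C\<^sup>2)"
  \<comment> \<open>The degree \<open>m = 1\<close> with all weights 1 already bounds the admissible
    radii.\<close>
  define B where "B = lam * sqrt (real n * fact 1 * real (1 * n + 1)) * A ^ 1"
  have "r \<le> B / (real n * (e / 2))" if "?P r" for r
  proof -
    have "(r * (\<Sum>i<n. 1 * cmod (u $ i))) ^ 1 \<le> B"
      unfolding B_def
    proof (rule bohr_inequality_upper[OF n x op _ _ conjunct2[OF that] conjunct1[OF that]])
      fix z assume z: "z \<in> \<Omega>"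
      have "(\<Sum>i<n. (1 * cmod (z $ i))\<^sup>2) \<le> (\<Sum>i<n. C\<^sup>2)"
        by (intro sum_mono power_mono) (use C z in auto)
      then show "(\<Sum>i<n. (1 * cmod (z $ i))\<^sup>2) \<le> A\<^sup>2" by (simp add: A_def)
    qed (use lam u in \<open>auto simp: A_def\<close>)
    then have "r * (real n * (e / 2)) \<le> B" using e(1) by (simp add: u_def)
    then show ?thesis using e(1) n by (simp add: pos_le_divide_eq)
  qed
  then have bdd: "bdd_above (Collect ?P)" by (auto simp: bdd_above_def)
  define R where "R = Sup (Collect ?P)"
  have upper: "r \<le> R" if "?P r" for r unfolding R_def using bdd that by (intro cSup_upper) auto
  have R0: "R \<ge> 0" using upper[OF P0] .
  have "bohr_inequality n \<Omega> (id :: 'x \<Rightarrow> 'x) lam R"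
  proof (rule bohr_inequality_limit[OF sub R0])
    fix q :: real assume q: "0 < q" "q < 1"
    show "bohr_inequality n \<Omega> (id :: 'x \<Rightarrow> 'x) lam (q * R)"
    \<comment> \<open>For \<open>R = 0\<close> no admissible radius lies above \<open>q * R\<close>,
      but \<open>q * R\<close> is then the admissible radius 0.\<close>
    proof (cases "R = 0")
      case True
      then show ?thesis using P0 by simp
    next
      case False
      then have "q * R < R" using q R0 by simp
      then obtain r where r: "?P r" "q * R < r"
        using less_cSupD[of "Collect ?P" "q * R"] P0 unfolding R_def by auto
      have "0 \<le> q * R" using q R0 by simp
      then have "0 < r" using r by linarith
      then show ?thesis
        using bohr_inequality_mono[OF sub conjunct2[OF r(1)], of "q * R / r"] r q R0 by simp
    qed
  qed
  then have PR: "?P R" using R0 by simp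
  have "second_bohr_radius_space n \<Omega> X lam = R"
    unfolding second_bohr_radius_space_def second_bohr_radius_def
    by (rule Greatest_equality[of ?P, OF PR]) (rule upper)
  then show "0 \<le> second_bohr_radius_space n \<Omega> X lam"
    and "bohr_inequality n \<Omega> (id :: 'x \<Rightarrow> 'x) lam (second_bohr_radius_space n \<Omega> X lam)"
    using PR by simp_all
qed


section \<open>Lattice norms and their duals\<close>

lemma norm_onD:
  assumes "norm_on n N"
  shows norm_on_nonneg: "z \<in> carrier_vec n \<Longrightarrow> 0 \<le> N z"
    and norm_on_eq_0: "z \<in> carrier_vec n \<Longrightarrow> N z = 0 \<longleftrightarrow> z = 0\<^sub>v n"
    and norm_on_smult: "z \<in> carrier_vec n \<Longrightarrow> N (c \<cdot>\<^sub>v z) = cmod c * N z"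
    and norm_on_triangle: "z \<in> carrier_vec n \<Longrightarrow> w \<in> carrier_vec n \<Longrightarrow> N (z + w) \<le> N z + N w"
  using assms by (auto simp: norm_on_def)

lemma norm_on_unit_vec_pos:
  assumes "norm_on n N" "i < n"
  shows "0 < N (unit_vec n i)"
proof -
  have "unit_vec n i \<noteq> (0\<^sub>v n :: complex vec)"
    using assms(2) by (metis index_unit_vec(1) index_zero_vec(1) zero_neq_one)
  then show ?thesis
    using norm_on_nonneg[OF assms(1), of "unit_vec n i"] norm_on_eq_0[OF assms(1), of "unit_vec n i"] by force
qed

lemma norm_on_le_sum:
  assumes N: "norm_on n N" and z: "z \<in> carrier_vec n"
  shows "N z \<le> (\<Sum>i<n. cmod (z $ i) * N (unit_vec n i))"
proof -
  define p where "p k = vec n (\<lambda>i. if i < k then z $ i else 0)" for k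
  have "N (p k) \<le> (\<Sum>i<k. cmod (z $ i) * N (unit_vec n i))" if "k \<le> n" for k
    using that
  proof (induction k)
    case 0
    have "p 0 = 0\<^sub>v n" by (auto simp: p_def)
    then show ?case using norm_on_eq_0[OF N, of "0\<^sub>v n"] by simp
  next
    case (Suc k)
    have "p (Suc k) = p k + z $ k \<cdot>\<^sub>v unit_vec n k"
      using Suc.prems by (intro eq_vecI) (auto simp: p_def less_Suc_eq)
    moreover have "N (p k + z $ k \<cdot>\<^sub>v unit_vec n k) \<le> N (p k) + N (z $ k \<cdot>\<^sub>v unit_vec n k)"
      by (rule norm_on_triangle[OF N]) (simp_all add: p_def)
    ultimately show ?case using Suc norm_on_smult[OF N, of "unit_vec n k"] by simp
  qed
  moreover have "p n = z" using z by (auto simp: p_def)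
  ultimately show ?thesis by force
qed

lemma open_Cn_unit_ball:
  assumes N: "norm_on n N"
  shows "open_Cn n (unit_ball n N)"
  unfolding open_Cn_def
proof (intro conjI ballI)
  show "unit_ball n N \<subseteq> carrier_vec n" by (auto simp: unit_ball_def)
next
  fix w assume w: "w \<in> unit_ball n N"
  then have wc: "w \<in> carrier_vec n" and w1: "N w < 1" by (auto simp: unit_ball_def)
  define S where "S = (\<Sum>i<n. N (unit_vec n i))"
  have S: "S \<ge> 0" unfolding S_def by (intro sum_nonneg norm_on_nonneg[OF N]) simp
  show "\<exists>\<epsilon>>0. \<forall>z\<in>carrier_vec n. (\<forall>i<n. cmod (z $ i - w $ i) < \<epsilon>) \<longrightarrow> z \<in> unit_ball n N"
  proof (intro exI conjI ballI impI)
    \<comment> \<open>The \<open>+ 1\<close> keeps the denominator positive if \<open>S = 0\<close>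
      and makes the final inequality strict.\<close>
    show "(1 - N w) / (S + 1) > 0" using w1 S by simp
    fix z assume z: "z \<in> carrier_vec n" "\<forall>i<n. cmod (z $ i - w $ i) < (1 - N w) / (S + 1)"
    have "z = w + (z - w)" using z wc by (intro eq_vecI) auto
    then have "N z \<le> N w + N (z - w)" using norm_on_triangle[OF N wc, of "z - w"] z(1) wc by simp
    also have "N (z - w) \<le> (\<Sum>i<n. cmod ((z - w) $ i) * N (unit_vec n i))"
      by (rule norm_on_le_sum[OF N]) (use z wc in simp)
    also have "\<dots> \<le> (\<Sum>i<n. (1 - N w) / (S + 1) * N (unit_vec n i))"
    proof (intro sum_mono mult_right_mono)
      fix i assume "i \<in> {..<n}"
      then show "cmod ((z - w) $ i) \<le> (1 - N w) / (S + 1)" using z wc by (simp add: less_imp_le)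
    qed (simp add: norm_on_nonneg[OF N])
    also have "\<dots> = (1 - N w) / (S + 1) * S" by (simp only: S_def sum_distrib_left)
    also have "\<dots> = (1 - N w) * (S / (S + 1))" by simp
    also have "\<dots> < (1 - N w) * 1" using w1 S by (intro mult_strict_left_mono) auto
    finally have "N z < 1" by simp
    then show "z \<in> unit_ball n N" using z by (simp add: unit_ball_def)
  qed
qed

lemma zero_in_unit_ball: "norm_on n N \<Longrightarrow> 0\<^sub>v n \<in> unit_ball n N"
  using norm_on_eq_0[of n N "0\<^sub>v n"] by (simp add: unit_ball_def)

text \<open>The form in which the unconditional basis constant 1 enters: phases of coordinates may
  be changed and moduli decreased without increasing the norm.\<close>

definition lattice_norm :: "nat \<Rightarrow> (complex vec \<Rightarrow> real) \<Rightarrow> bool" where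
  "lattice_norm n N \<longleftrightarrow> norm_on n N \<and> (\<forall>z\<in>carrier_vec n. \<forall>w\<in>carrier_vec n.
     (\<forall>i<n. cmod (z $ i) \<le> cmod (w $ i)) \<longrightarrow> N z \<le> N w)"

lemma finsum_vec_unit_vec:
  "finsum_vec TYPE(complex) n (\<lambda>k. a k \<cdot>\<^sub>v unit_vec n k) {..<n} = vec n a" (is "?f = _")
proof (rule eq_vecI)
  have "?f \<in> carrier_vec n" by (rule finsum_vec_closed) auto
  then show "dim_vec ?f = dim_vec (vec n a)" by auto
  fix i assume "i < dim_vec (vec n a)"
  then have i: "i < n" by simp
  have "?f $ i = (\<Sum>k<n. (a k \<cdot>\<^sub>v unit_vec n k) $ i)"
    by (rule index_finsum_vec) (use i in auto)
  also have "\<dots> = (\<Sum>k<n. if k = i then a i else 0)"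
    using i by (intro sum.cong refl) auto
  finally show "?f $ i = vec n a $ i" using i by simp
qed

text \<open>\<open>unconditional_const\<close> is a \<open>LEAST\<close>, so its value is
  informative only once a least bound exists. The infimum of the bounds is again a bound, hence 1 is
  one; and \<open>z\<close> arises from \<open>w\<close> by multipliers of modulus at most
  1.\<close>

lemma lattice_norm_of_unconditional:
  assumes N: "norm_on n N" and ub: "unconditional_basis n N (unit_vec n)"
    and K1: "unconditional_const n N (unit_vec n) = 1"
  shows "lattice_norm n N"
proof -
  have eq: "unconditional_bound n N (unit_vec n) K \<longleftrightarrow> 0 \<le> K \<and>
     (\<forall>\<zeta>\<in>carrier_vec n. \<forall>a\<in>carrier_vec n. (\<forall>k<n. cmod (\<zeta> $ k) \<le> 1) \<longrightarrow>
        N (vec n (\<lambda>k. \<zeta> $ k * a $ k)) \<le> K * N a)" for K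
  proof -
    have "vec n (\<lambda>k. a $ k) = a" if "a \<in> carrier_vec n" for a :: "complex vec"
      using that by (intro eq_vecI) auto
    then show ?thesis unfolding unconditional_bound_def finsum_vec_unit_vec by simp
  qed
  let ?B = "Collect (unconditional_bound n N (unit_vec n))"
  obtain K0 where K0: "unconditional_bound n N (unit_vec n) K0"
    using ub unfolding unconditional_basis_def by blast
  have bdd: "bdd_below ?B" by (rule bdd_belowI[of _ 0]) (auto simp: eq)
  have "unconditional_bound n N (unit_vec n) (Inf ?B)"
  proof (rule eq[THEN iffD2], intro conjI ballI impI)
    show "0 \<le> Inf ?B" by (rule cInf_greatest) (use K0 in \<open>auto simp: eq\<close>)
    fix \<zeta> a :: "complex vec"
    assume za: "\<zeta> \<in> carrier_vec n" "a \<in> carrier_vec n" "\<forall>k<n. cmod (\<zeta> $ k) \<le> 1"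
    let ?v = "vec n (\<lambda>k. \<zeta> $ k * a $ k)"
    have le: "N ?v \<le> K * N a" if "K \<in> ?B" for K using that za by (simp add: eq)
    show "N ?v \<le> Inf ?B * N a"
    proof (cases "N a = 0")
      case True
      then show ?thesis using le[of K0] K0 by simp
    next
      case False
      then have pos: "N a > 0" using norm_on_nonneg[OF N za(2)] by simp
      have "N ?v / N a \<le> Inf ?B"
        by (rule cInf_greatest) (use K0 le pos in \<open>auto simp: divide_le_eq\<close>)
      then show ?thesis using pos by (simp add: divide_le_eq)
    qed
  qed
  then have "unconditional_const n N (unit_vec n) = Inf ?B"
    unfolding unconditional_const_def by (rule Least_equality) (auto intro: cInf_lower bdd)
  then have one: "unconditional_bound n N (unit_vec n) 1"
    using K1 \<open>unconditional_bound n N (unit_vec n) (Inf ?B)\<close> by simp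
  have "N z \<le> N w" if zw: "z \<in> carrier_vec n" "w \<in> carrier_vec n" "\<forall>i<n. cmod (z $ i) \<le> cmod (w $ i)" for z w
  proof -
    \<comment> \<open>Where \<open>w $ i = 0\<close>, also \<open>z $ i = 0\<close>, so the quotient
      0 is a correct multiplier.\<close>
    let ?\<zeta> = "vec n (\<lambda>i. z $ i / w $ i)"
    have "\<forall>k<n. cmod (?\<zeta> $ k) \<le> 1"
      using zw(3) by (auto simp: norm_divide divide_le_eq)
    then have "N (vec n (\<lambda>k. ?\<zeta> $ k * w $ k)) \<le> 1 * N w"
      using one zw(2) unfolding eq by (meson vec_carrier)
    moreover have "vec n (\<lambda>k. ?\<zeta> $ k * w $ k) = z"
      using zw by (intro eq_vecI) auto
    ultimately show ?thesis by simp
  qed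
  then show ?thesis using N by (simp add: lattice_norm_def)
qed

lemma lattice_normD:
  assumes "lattice_norm n N"
  shows lattice_norm_norm_on: "norm_on n N"
    and lattice_norm_mono: "\<lbrakk>z \<in> carrier_vec n; w \<in> carrier_vec n;
      \<And>i. i < n \<Longrightarrow> cmod (z $ i) \<le> cmod (w $ i)\<rbrakk> \<Longrightarrow> N z \<le> N w"
  using assms by (auto simp: lattice_norm_def)

lemma lattice_norm_coordinate:
  assumes N: "lattice_norm n N" and z: "z \<in> carrier_vec n" and i: "i < n"
  shows "cmod (z $ i) * N (unit_vec n i) \<le> N z"
proof -
  have "N (z $ i \<cdot>\<^sub>v unit_vec n i) \<le> N z"
    by (rule lattice_norm_mono[OF N]) (use z i in auto)
  then show ?thesis using norm_on_smult[OF lattice_norm_norm_on[OF N], of "unit_vec n i"] by simp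
qed

section \<open>The dual norm\<close>

lemma scalar_prod_lessThan:
  "z \<in> carrier_vec n \<Longrightarrow> w \<bullet> z = (\<Sum>i<n. w $ i * z $ i)"
  by (simp add: scalar_prod_def atLeast0LessThan)

lemma scalar_prod_unit_vec:
  "(i::nat) < n \<Longrightarrow> (w :: complex vec) \<bullet> unit_vec n i = w $ i"
  by (simp add: scalar_prod_lessThan if_distrib cong: if_cong)

text \<open>The supremum in \<open>dual_norm\<close> is one of reals and has its meaning only for
  bounded sets. A lattice norm bounds each coordinate on the unit ball.\<close>

lemma dual_norm_bdd:
  assumes N: "lattice_norm n N"
  shows "bdd_above ((\<lambda>z. cmod (w \<bullet> z)) ` {z \<in> carrier_vec n. N z \<le> 1})"
proof (rule bdd_aboveI2)
  fix z assume z: "z \<in> {z \<in> carrier_vec n. N z \<le> 1}"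
  have "cmod (w \<bullet> z) \<le> (\<Sum>i<n. cmod (w $ i * z $ i))"
    using z scalar_prod_lessThan[of z n w] norm_sum[of "\<lambda>i. w $ i * z $ i" "{..<n}"] by simp
  also have "\<dots> \<le> (\<Sum>i<n. cmod (w $ i) * (1 / N (unit_vec n i)))"
  proof (intro sum_mono)
    fix i assume i: "i \<in> {..<n}"
    have "cmod (z $ i) * N (unit_vec n i) \<le> 1"
      using lattice_norm_coordinate[OF N, of z i] z i by simp
    then have "cmod (z $ i) \<le> 1 / N (unit_vec n i)"
      using norm_on_unit_vec_pos[OF lattice_norm_norm_on[OF N], of i] i by (simp add: le_divide_eq)
    then show "cmod (w $ i * z $ i) \<le> cmod (w $ i) * (1 / N (unit_vec n i))"
      unfolding norm_mult by (rule mult_left_mono) simp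
  qed
  finally show "cmod (w \<bullet> z) \<le> (\<Sum>i<n. cmod (w $ i) * (1 / N (unit_vec n i)))" .
qed

lemma dual_norm_least:
  assumes "norm_on n N" "\<And>z. \<lbrakk>z \<in> carrier_vec n; N z \<le> 1\<rbrakk> \<Longrightarrow> cmod (w \<bullet> z) \<le> c"
  shows "dual_norm n N w \<le> c"
proof -
  have "0\<^sub>v n \<in> {z \<in> carrier_vec n. N z \<le> 1}" using norm_on_eq_0[OF assms(1), of "0\<^sub>v n"] by simp
  then show ?thesis unfolding dual_norm_def by (intro cSUP_least) (use assms(2) in blast)+
qed

lemma dual_norm_upper:
  assumes N: "lattice_norm n N" and z: "z \<in> carrier_vec n"
  shows "cmod (w \<bullet> z) \<le> dual_norm n N w * N z"
proof (cases "N z = 0")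
  case True
  then have "z = 0\<^sub>v n" using norm_on_eq_0[OF lattice_norm_norm_on[OF N] z] by simp
  then show ?thesis using True by (simp add: scalar_prod_def)
next
  case False
  then have pos: "N z > 0" using norm_on_nonneg[OF lattice_norm_norm_on[OF N] z] by simp
  let ?y = "complex_of_real (1 / N z) \<cdot>\<^sub>v z"
  have "N ?y = 1" using norm_on_smult[OF lattice_norm_norm_on[OF N] z] pos by (simp add: norm_divide)
  then have "cmod (w \<bullet> ?y) \<le> dual_norm n N w"
    unfolding dual_norm_def using z by (intro cSUP_upper dual_norm_bdd[OF N]) simp
  moreover have "w \<bullet> ?y = complex_of_real (1 / N z) * (w \<bullet> z)"
    using z by (simp add: scalar_prod_lessThan sum_distrib_left)
  ultimately show ?thesis using pos by (simp add: norm_mult norm_divide divide_le_eq)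
qed

lemma dual_norm_coordinate:
  assumes N: "lattice_norm n N" and i: "i < n"
  shows "cmod (w $ i) \<le> dual_norm n N w * N (unit_vec n i)"
  using dual_norm_upper[OF N, of "unit_vec n i" w] i by (simp add: scalar_prod_unit_vec)

lemma dual_norm_nonneg:
  assumes N: "lattice_norm n N"
  shows "0 \<le> dual_norm n N w"
proof -
  have "0\<^sub>v n \<in> {z \<in> carrier_vec n. N z \<le> 1}"
    using norm_on_eq_0[OF lattice_norm_norm_on[OF N], of "0\<^sub>v n"] by simp
  then have "cmod (w \<bullet> 0\<^sub>v n) \<le> dual_norm n N w"
    unfolding dual_norm_def by (intro cSUP_upper dual_norm_bdd[OF N])
  then show ?thesis using norm_ge_zero order_trans by blast
qed

lemma norm_on_dual_norm:
  assumes N: "lattice_norm n N"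
  shows "norm_on n (dual_norm n N)"
proof -
  note no = lattice_norm_norm_on[OF N]
  have smult_le: "dual_norm n N (c \<cdot>\<^sub>v w) \<le> cmod c * dual_norm n N w" if w: "w \<in> carrier_vec n" for c w
  proof (rule dual_norm_least[OF no])
    fix z assume z: "z \<in> carrier_vec n" "N z \<le> 1"
    have "cmod ((c \<cdot>\<^sub>v w) \<bullet> z) = cmod c * cmod (w \<bullet> z)"
      using w z by (simp flip: norm_mult)
    also have "\<dots> \<le> cmod c * (dual_norm n N w * 1)"
      using dual_norm_upper[OF N z(1), of w] z(2) dual_norm_nonneg[OF N, of w]
      by (intro mult_left_mono order_trans[OF dual_norm_upper[OF N z(1)]] mult_left_mono) auto
    finally show "cmod ((c \<cdot>\<^sub>v w) \<bullet> z) \<le> cmod c * dual_norm n N w" by simp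
  qed
  have zero: "dual_norm n N w = 0 \<longleftrightarrow> w = 0\<^sub>v n" if w: "w \<in> carrier_vec n" for w
  proof
    assume "dual_norm n N w = 0"
    then have "w $ i = 0" if "i < n" for i using dual_norm_coordinate[OF N that, of w] by simp
    then show "w = 0\<^sub>v n" using w by (intro eq_vecI) auto
  next
    assume "w = 0\<^sub>v n"
    then have "dual_norm n N w \<le> 0" by (intro dual_norm_least[OF no]) auto
    then show "dual_norm n N w = 0" using dual_norm_nonneg[OF N, of w] by simp
  qed
  have smult: "dual_norm n N (c \<cdot>\<^sub>v w) = cmod c * dual_norm n N w" if w: "w \<in> carrier_vec n" for c w
  proof (cases "c = 0")
    case True
    then have "c \<cdot>\<^sub>v w = 0\<^sub>v n" using w by (intro eq_vecI) auto
    then show ?thesis using True zero[of "0\<^sub>v n"] by simp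
  next
    case False
    have "inverse c \<cdot>\<^sub>v (c \<cdot>\<^sub>v w) = w" using False by (simp add: smult_smult_assoc)
    then have "dual_norm n N w \<le> cmod (inverse c) * dual_norm n N (c \<cdot>\<^sub>v w)"
      using smult_le[of "c \<cdot>\<^sub>v w" "inverse c"] w by simp
    then have "cmod c * dual_norm n N w \<le> dual_norm n N (c \<cdot>\<^sub>v w)"
      using False by (simp add: norm_inverse norm_divide field_simps)
    then show ?thesis using smult_le[OF w, of c] by simp
  qed
  have tri: "dual_norm n N (v + w) \<le> dual_norm n N v + dual_norm n N w"
    if vw: "v \<in> carrier_vec n" "w \<in> carrier_vec n" for v w
  proof (rule dual_norm_least[OF no])
    fix z assume z: "z \<in> carrier_vec n" "N z \<le> 1"
    have le: "cmod (y \<bullet> z) \<le> dual_norm n N y" for y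
      using dual_norm_upper[OF N z(1), of y] mult_left_mono[OF z(2) dual_norm_nonneg[OF N, of y]] by simp
    have "(v + w) \<bullet> z = v \<bullet> z + w \<bullet> z" using vw z by (simp add: add_scalar_prod_distrib[of _ n])
    then show "cmod ((v + w) \<bullet> z) \<le> dual_norm n N v + dual_norm n N w"
      using norm_triangle_ineq[of "v \<bullet> z" "w \<bullet> z"] le[of v] le[of w] by simp
  qed
  show ?thesis unfolding norm_on_def using dual_norm_nonneg[OF N] zero smult tri by blast
qed

text \<open>A lattice norm allows the phases of \<open>z\<close> to be turned so that all terms of
  the pairing with \<open>w\<close> become nonnegative.\<close>

lemma dual_norm_pairing:
  assumes N: "lattice_norm n N" and z: "z \<in> carrier_vec n"
  shows "(\<Sum>i<n. cmod (w $ i) * cmod (z $ i)) \<le> dual_norm n N w * N z"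
proof -
  \<comment> \<open>As \<open>sgn 0 = 0\<close>, coordinates off the support of \<open>w\<close> are
    dropped, which is why only \<open>N y \<le> N z\<close> is claimed.\<close>
  define y where "y = vec n (\<lambda>i. complex_of_real (cmod (z $ i)) * cnj (sgn (w $ i)))"
  have yc: "y \<in> carrier_vec n" by (simp add: y_def)
  have "w \<bullet> y = (\<Sum>i<n. complex_of_real (cmod (w $ i) * cmod (z $ i)))"
    unfolding scalar_prod_lessThan[OF yc]
  proof (intro sum.cong refl)
    fix i assume i: "i \<in> {..<n}"
    have "w $ i * cnj (sgn (w $ i)) = complex_of_real (cmod (w $ i))"
      by (cases "w $ i = 0") (simp_all add: sgn_eq complex_norm_square[symmetric] power2_eq_square)
    then show "w $ i * y $ i = complex_of_real (cmod (w $ i) * cmod (z $ i))"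
      using i by (simp add: y_def mult.left_commute)
  qed
  then have "cmod (w \<bullet> y) = (\<Sum>i<n. cmod (w $ i) * cmod (z $ i))"
    by (simp only: of_real_sum[symmetric] norm_of_real) (simp add: sum_nonneg)
  moreover have "cmod (w \<bullet> y) \<le> dual_norm n N w * N y" by (rule dual_norm_upper[OF N yc])
  moreover have "N y \<le> N z"
    by (rule lattice_norm_mono[OF N yc z]) (auto simp: y_def norm_mult norm_sgn)
  then have "dual_norm n N w * N y \<le> dual_norm n N w * N z"
    by (rule mult_left_mono[OF _ dual_norm_nonneg[OF N]])
  ultimately show ?thesis by simp
qed


section \<open>Products of Bohr radii\<close>

text \<open>The choice of \<open>m\<close> balances two effects of the \<open>m\<close>-th root:
  \<open>n \<le> exp m\<close> reduces powers of \<open>n\<close> to constants, while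
  \<open>fact m \<le> m ^ m\<close> costs a factor \<open>m\<close>, which is of order
  \<open>ln n\<close>.\<close>

lemma bohr_constant_bound:
  assumes n: "n \<ge> 2" and lam: "lam \<ge> 1" and m: "m = nat \<lceil>ln (real n)\<rceil>"
    and \<kappa>: "\<kappa> \<ge> 0" "\<kappa> ^ m = lam * sqrt (real n * fact m * real (m * n + 1))"
  shows "m \<ge> 1" and "\<kappa>\<^sup>2 \<le> 8 * lam\<^sup>2 * exp 6 * ln (real n)"
proof -
  have lnpos: "ln (real n) > 0" using n by simp
  have mle: "ln (real n) \<le> real m" and mlt: "real m < ln (real n) + 1"
    using lnpos unfolding m by linarith+
  show m1: "m \<ge> 1" using mle lnpos by (cases m) auto
  have ne: "real n \<le> exp (real m)" 
  proof -
    have "real n = exp (ln (real n))" using n by simp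
    also have "\<dots> \<le> exp (real m)" using mle by (simp only: exp_le_cancel_iff)
    finally show ?thesis .
  qed
  \<comment> \<open>This absorbs the rounding up in \<open>m\<close>:
    \<open>ln n + 1 \<le> 3 * ln n\<close>.\<close>
  have half: "ln (real n) \<ge> 1 / 2"
  proof -
    have "ln (1 / 2 :: real) \<le> 1 / 2 - 1" by (rule ln_le_minus_one) simp
    then have "1 / 2 \<le> ln (2 :: real)" by (simp add: ln_div)
    also have "\<dots> \<le> ln (real n)" using n by simp
    finally show ?thesis .
  qed
  have m2: "real m \<le> 3 * ln (real n)" using mlt half by linarith
  have "(\<kappa>\<^sup>2) ^ m = (\<kappa> ^ m)\<^sup>2" by (simp add: mult.commute flip: power_mult)
  also have "\<dots> = lam\<^sup>2 * (real n * fact m * real (m * n + 1))"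
    unfolding \<kappa>(2) power_mult_distrib by (subst real_sqrt_pow2) simp_all
  also have "\<dots> \<le> (lam\<^sup>2) ^ m * (exp (real m) * real m ^ m * (exp (real m) * exp (real m)))"
  proof (intro mult_mono)
    show "lam\<^sup>2 \<le> (lam\<^sup>2) ^ m" using lam m1 by (simp add: self_le_power)
    show "(fact m :: real) \<le> real m ^ m" using fact_le_power[of m, where 'a = real] by simp
    \<comment> \<open>One factor \<open>exp m\<close> for \<open>n\<close> and one for
      \<open>1 + m\<close>; with the third for the separate factor \<open>n\<close>, the root turns
      them into \<open>exp 3\<close>.\<close>
    have "real (m * n + 1) \<le> real n * (1 + real m)" using n by (simp add: algebra_simps)
    also have "\<dots> \<le> exp (real m) * exp (real m)"
      by (intro mult_mono ne exp_ge_add_one_self) auto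
    finally show "real (m * n + 1) \<le> exp (real m) * exp (real m)" .
  qed (use ne in auto)
  also have "\<dots> = (lam\<^sup>2 * exp 3 * real m) ^ m"
  proof -
    have "exp (real m) * exp (real m) * exp (real m) = exp (3::real) ^ m"
      by (simp flip: exp_add exp_of_nat_mult)
    then show ?thesis by (simp add: power_mult_distrib mult_ac)
  qed
  finally have "(\<kappa>\<^sup>2) ^ m \<le> (lam\<^sup>2 * exp 3 * real m) ^ m" .
  then have "\<kappa>\<^sup>2 \<le> lam\<^sup>2 * exp 3 * real m"
    using power_mono_iff[of "\<kappa>\<^sup>2" "lam\<^sup>2 * exp 3 * real m" m] m1 by simp
  \<comment> \<open>There is room to spare: \<open>exp 3 \<le> exp 6\<close>, and
    \<open>m \<le> 3 * ln n\<close> where 8 is allowed.\<close>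
  also have "\<dots> \<le> lam\<^sup>2 * exp 6 * (8 * ln (real n))"
    using m2 lnpos by (intro mult_mono) auto
  finally show "\<kappa>\<^sup>2 \<le> 8 * lam\<^sup>2 * exp 6 * ln (real n)" by (simp add: mult_ac)
qed

text \<open>The estimate for the radius of the ball bounds the dual norm of the weight vector by
  \<kappa> \<open>* A / r\<close>. Scaled into the dual ball, that vector is tested in the estimate
  for the dual radius, where the weights \<open>1 / s i\<close> cancel and the sum is a multiple of
  \<open>n\<close>.\<close>

lemma bohr_product_weighted:
  fixes X :: "'x::complex_banach itself" and x :: 'x
  assumes n: "n \<ge> 2" and x: "x \<noteq> 0" and lam: "lam \<ge> 1" and N: "lattice_norm n N"
    and s: "\<And>i. i < n \<Longrightarrow> s i > 0" and A: "A \<ge> 0" and B: "B \<ge> 0"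
    and boundA: "\<And>z. \<lbrakk>z \<in> carrier_vec n; N z \<le> 1\<rbrakk> \<Longrightarrow> (\<Sum>i<n. (s i * cmod (z $ i))\<^sup>2) \<le> A\<^sup>2"
    and boundB: "\<And>w. \<lbrakk>w \<in> carrier_vec n; dual_norm n N w \<le> 1\<rbrakk> \<Longrightarrow> (\<Sum>i<n. (1 / s i * cmod (w $ i))\<^sup>2) \<le> B\<^sup>2"
  shows "0 \<le> bohr_product n N X lam"
    and "bohr_product n N X lam \<le> 8 * lam\<^sup>2 * exp 6 * ln (real n) * (A * B) / real n"
proof -
  note no = lattice_norm_norm_on[OF N] and dno = norm_on_dual_norm[OF N]
  define r where "r = second_bohr_radius_space n (unit_ball n N) X lam"
  define r' where "r' = second_bohr_radius_space n (unit_ball n (dual_norm n N)) X lam"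
  have n1: "n \<ge> 1" using n by simp
  define C where "C = (\<Sum>i<n. 1 / N (unit_vec n i))"
  define C' where "C' = (\<Sum>i<n. N (unit_vec n i))"
  have r: "0 \<le> r" "bohr_inequality n (unit_ball n N) (id :: 'x \<Rightarrow> 'x) lam r"
    unfolding r_def
  proof -
    have "cmod (z $ i) \<le> C" if z: "z \<in> unit_ball n N" and i: "i < n" for z i
    proof -
      have "cmod (z $ i) * N (unit_vec n i) \<le> 1"
        using lattice_norm_coordinate[OF N, of z i] z i by (simp add: unit_ball_def)
      then have "cmod (z $ i) \<le> 1 / N (unit_vec n i)"
        using norm_on_unit_vec_pos[OF no i] by (simp add: le_divide_eq)
      also have "\<dots> \<le> C" unfolding C_def
        by (rule member_le_sum) (use i norm_on_unit_vec_pos[OF no] in \<open>auto intro: less_imp_le\<close>)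
      finally show ?thesis .
    qed
    note * = second_bohr_radius_space_admissible[OF n1 x open_Cn_unit_ball[OF no] zero_in_unit_ball[OF no] this lam]
    show "0 \<le> second_bohr_radius_space n (unit_ball n N) X lam"
      "bohr_inequality n (unit_ball n N) (id :: 'x \<Rightarrow> 'x) lam (second_bohr_radius_space n (unit_ball n N) X lam)"
      by (rule *; assumption)+
  qed
  have r': "0 \<le> r'" "bohr_inequality n (unit_ball n (dual_norm n N)) (id :: 'x \<Rightarrow> 'x) lam r'"
    unfolding r'_def
  proof -
    have "cmod (w $ i) \<le> C'" if w: "w \<in> unit_ball n (dual_norm n N)" and i: "i < n" for w i
    proof -
      have "cmod (w $ i) \<le> dual_norm n N w * N (unit_vec n i)" by (rule dual_norm_coordinate[OF N i])
      also have "\<dots> \<le> 1 * N (unit_vec n i)"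
        using w norm_on_unit_vec_pos[OF no i] by (intro mult_right_mono) (auto simp: unit_ball_def)
      also have "\<dots> \<le> C'" unfolding C'_def mult_1
        by (rule member_le_sum) (use i norm_on_unit_vec_pos[OF no] in \<open>auto intro: less_imp_le\<close>)
      finally show ?thesis .
    qed
    note * = second_bohr_radius_space_admissible[OF n1 x open_Cn_unit_ball[OF dno] zero_in_unit_ball[OF dno] this lam]
    show "0 \<le> second_bohr_radius_space n (unit_ball n (dual_norm n N)) X lam"
      "bohr_inequality n (unit_ball n (dual_norm n N)) (id :: 'x \<Rightarrow> 'x) lam
         (second_bohr_radius_space n (unit_ball n (dual_norm n N)) X lam)"
      by (rule *; assumption)+
  qed
  have prod: "bohr_product n N X lam = r * r'" by (simp add: bohr_product_def r_def r'_def)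
  show "0 \<le> bohr_product n N X lam" using r r' prod by simp
  define m where "m = nat \<lceil>ln (real n)\<rceil>"
  define K where "K = lam * sqrt (real n * fact m * real (m * n + 1))"
  have K0: "K \<ge> 0" using lam by (simp add: K_def)
  have m0: "m > 0" using n by (simp add: m_def)
  define \<kappa> where "\<kappa> = root m K"
  have \<kappa>: "\<kappa> \<ge> 0" "\<kappa> ^ m = K" using K0 m0 by (simp_all add: \<kappa>_def)
  have \<kappa>2: "\<kappa>\<^sup>2 \<le> 8 * lam\<^sup>2 * exp 6 * ln (real n)"
    by (rule bohr_constant_bound(2)[OF n lam m_def \<kappa>(1) \<kappa>(2)[unfolded K_def]])
  have base: "t \<le> \<kappa> * D" if "t ^ m \<le> K * D ^ m" "t \<ge> 0" "D \<ge> 0" for t D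
  proof -
    have "t ^ m \<le> (\<kappa> * D) ^ m" using that(1) by (simp only: power_mult_distrib \<kappa>(2))
    then show ?thesis using power_mono_iff[of t "\<kappa> * D" m] that \<kappa>(1) m0 by simp
  qed
  have upper: "r * (\<Sum>i<n. s i * cmod (u $ i)) \<le> \<kappa> * A" if u: "u \<in> unit_ball n N" for u
  proof (rule base)
    show "(r * (\<Sum>i<n. s i * cmod (u $ i))) ^ m \<le> K * A ^ m"
      unfolding K_def
      by (rule bohr_inequality_upper[OF n1 x open_Cn_unit_ball[OF no] _ A r(2,1) _ _ u])
        (use lam s boundA in \<open>auto simp: unit_ball_def less_imp_le\<close>)
    show "r * (\<Sum>i<n. s i * cmod (u $ i)) \<ge> 0"
      using r s by (intro mult_nonneg_nonneg sum_nonneg) (auto simp: less_imp_le)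
  qed (rule A)
  have upper': "r' * (\<Sum>i<n. 1 / s i * cmod (u $ i)) \<le> \<kappa> * B" if u: "u \<in> unit_ball n (dual_norm n N)" for u
  proof (rule base)
    show "(r' * (\<Sum>i<n. 1 / s i * cmod (u $ i))) ^ m \<le> K * B ^ m"
      unfolding K_def
      by (rule bohr_inequality_upper[OF n1 x open_Cn_unit_ball[OF dno] _ B r'(2,1) _ _ u])
        (use lam s boundB in \<open>auto simp: unit_ball_def less_imp_le\<close>)
    show "r' * (\<Sum>i<n. 1 / s i * cmod (u $ i)) \<ge> 0"
      using r' s by (intro mult_nonneg_nonneg sum_nonneg) (auto simp: less_imp_le)
  qed (rule B)
  have main: "r * r' * real n \<le> \<kappa>\<^sup>2 * (A * B)"
  proof (cases "r = 0")
    case True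
    then show ?thesis using A B by simp
  next
    case False
    then have rpos: "r > 0" using r by simp
    \<comment> \<open>By \<open>upper\<close>, the weight vector \<open>S\<close>, seen as a
      functional, is bounded by \<open>a\<close> on the unit ball.\<close>
    define a where "a = \<kappa> * A / r"
    define S where "S = vec n (\<lambda>i. complex_of_real (s i))"
    have Sc: "S \<in> carrier_vec n" by (simp add: S_def)
    have dS: "dual_norm n N S \<le> a"
    proof (rule dual_norm_least[OF no])
      fix z assume z: "z \<in> carrier_vec n" "N z \<le> 1"
      have "cmod (S \<bullet> z) \<le> (\<Sum>i<n. s i * cmod (z $ i))"
      proof -
        have "cmod (S \<bullet> z) \<le> (\<Sum>i<n. cmod (S $ i * z $ i))"
          using scalar_prod_lessThan[OF z(1), of S] norm_sum[of "\<lambda>i. S $ i * z $ i" "{..<n}"] by simp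
        also have "\<dots> = (\<Sum>i<n. s i * cmod (z $ i))"
          by (intro sum.cong refl) (use s in \<open>auto simp: S_def norm_mult less_imp_le\<close>)
        finally show ?thesis .
      qed
      \<comment> \<open>\<open>upper\<close> concerns the open ball and the dual norm the closed
        one, hence the scaling by \<open>c < 1\<close>.\<close>
      also have "\<dots> \<le> a"
      proof (rule field_le_mult_one_interval)
        fix c :: real assume c: "0 < c" "c < 1"
        have "N (complex_of_real c \<cdot>\<^sub>v z) \<le> c * 1"
          using norm_on_smult[OF no z(1)] c z(2) by simp
        then have "complex_of_real c \<cdot>\<^sub>v z \<in> unit_ball n N" using c z by (simp add: unit_ball_def)
        from upper[OF this] have "r * (c * (\<Sum>i<n. s i * cmod (z $ i))) \<le> \<kappa> * A"
          using z c by (simp add: norm_mult sum_distrib_left mult_ac)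
        then show "c * (\<Sum>i<n. s i * cmod (z $ i)) \<le> a"
          using rpos by (simp add: a_def le_divide_eq mult_ac)
      qed
      finally show "cmod (S \<bullet> z) \<le> a" .
    qed
    have "0 < cmod (S $ 0)" using s[of 0] n by (simp add: S_def)
    also have "\<dots> \<le> dual_norm n N S * N (unit_vec n 0)" by (rule dual_norm_coordinate[OF N]) (use n in simp)
    finally have "dual_norm n N S > 0"
      using norm_on_unit_vec_pos[OF no, of 0] n by (simp add: zero_less_mult_iff)
    then have apos: "a > 0" using dS by simp
    \<comment> \<open>The test vector is \<open>S\<close> scaled by \<open>c / a\<close> into the
      open dual ball; each of its \<open>n\<close> weighted coordinates is
      \<open>c / a\<close>.\<close>
    have "r' * real n / a \<le> \<kappa> * B"
    proof (rule field_le_mult_one_interval)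
      fix c :: real assume c: "0 < c" "c < 1"
      have "dual_norm n N (complex_of_real (c / a) \<cdot>\<^sub>v S) = c / a * dual_norm n N S"
        using norm_on_smult[OF dno Sc, of "complex_of_real (c / a)"] c apos by (simp add: norm_divide)
      also have "\<dots> \<le> c / a * a" by (rule mult_left_mono[OF dS]) (use c apos in simp)
      finally have "complex_of_real (c / a) \<cdot>\<^sub>v S \<in> unit_ball n (dual_norm n N)"
        using c apos Sc by (simp add: unit_ball_def)
      from upper'[OF this] have "r' * (\<Sum>i<n. 1 / s i * cmod ((complex_of_real (c / a) \<cdot>\<^sub>v S) $ i)) \<le> \<kappa> * B" .
      also have "(\<Sum>i<n. 1 / s i * cmod ((complex_of_real (c / a) \<cdot>\<^sub>v S) $ i)) = (\<Sum>i<n. c / a)"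
      proof (intro sum.cong refl)
        fix i assume "i \<in> {..<n}"
        then show "1 / s i * cmod ((complex_of_real (c / a) \<cdot>\<^sub>v S) $ i) = c / a"
          using s[of i] c apos by (simp add: S_def norm_mult norm_divide)
      qed
      finally show "c * (r' * real n / a) \<le> \<kappa> * B" by (simp add: mult_ac)
    qed
    then have "r' * real n \<le> \<kappa> * B * (\<kappa> * A / r)"
      unfolding pos_divide_le_eq[OF apos] by (simp only: a_def)
    then show ?thesis using rpos by (simp add: le_divide_eq power2_eq_square mult_ac)
  qed
  have "\<kappa>\<^sup>2 * (A * B) \<le> 8 * lam\<^sup>2 * exp 6 * ln (real n) * (A * B)"
    by (rule mult_right_mono[OF \<kappa>2]) (use A B in simp)
  then show "bohr_product n N X lam \<le> 8 * lam\<^sup>2 * exp 6 * ln (real n) * (A * B) / real n"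
    using main n unfolding prod by (simp add: le_divide_eq)
qed


section \<open>Diagonal operators and the Banach--Mazur distance\<close>

lemma lattice_norm_l2_norm: "lattice_norm n (l2_norm n)"
  unfolding lattice_norm_def norm_on_def
proof (intro conjI ballI allI impI)
  fix z w :: "complex vec" assume z: "z \<in> carrier_vec n"
  show "0 \<le> l2_norm n z" by (simp add: l2_norm_def L2_set_nonneg)
  show "l2_norm n z = 0 \<longleftrightarrow> z = 0\<^sub>v n"
    using z by (auto simp: l2_norm_def L2_set_eq_0_iff intro!: eq_vecI)
  show "l2_norm n (c \<cdot>\<^sub>v z) = cmod c * l2_norm n z" for c
  proof -
    have "l2_norm n (c \<cdot>\<^sub>v z) = L2_set (\<lambda>i. cmod c * cmod (z $ i)) {..<n}"
      unfolding l2_norm_def by (rule L2_set_cong) (use z in \<open>auto simp: norm_mult\<close>)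
    then show ?thesis by (simp add: l2_norm_def L2_set_right_distrib)
  qed
  assume w: "w \<in> carrier_vec n"
  have "l2_norm n (z + w) \<le> L2_set (\<lambda>i. cmod (z $ i) + cmod (w $ i)) {..<n}"
    unfolding l2_norm_def by (rule L2_set_mono) (use z w in \<open>auto simp: norm_triangle_ineq\<close>)
  also have "\<dots> \<le> l2_norm n z + l2_norm n w" unfolding l2_norm_def by (rule L2_set_triangle_ineq)
  finally show "l2_norm n (z + w) \<le> l2_norm n z + l2_norm n w" .
  assume "\<forall>i<n. cmod (z $ i) \<le> cmod (w $ i)"
  then show "l2_norm n z \<le> l2_norm n w" unfolding l2_norm_def by (intro L2_set_mono) auto
qed

lemma l2_norm_power2: "(l2_norm n z)\<^sup>2 = (\<Sum>i<n. (cmod (z $ i))\<^sup>2)"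
  unfolding l2_norm_def L2_set_def by (rule real_sqrt_pow2) (simp add: sum_nonneg)

section \<open>Operator norms of matrices\<close>

lemma op_norm_bdd:
  assumes N: "lattice_norm n N" and M: "norm_on n M" and S: "S \<in> carrier_mat n n"
  shows "bdd_above ((\<lambda>z. M (S *\<^sub>v z)) ` {z \<in> carrier_vec n. N z \<le> 1})"
proof (rule bdd_aboveI2)
  fix z assume "z \<in> {z \<in> carrier_vec n. N z \<le> 1}"
  then have z: "z \<in> carrier_vec n" "N z \<le> 1" by auto
  have coord: "cmod (z $ j) \<le> 1 / N (unit_vec n j)" if j: "j < n" for j
  proof -
    have "cmod (z $ j) * N (unit_vec n j) \<le> 1" using lattice_norm_coordinate[OF N z(1) j] z(2) by simp
    then show ?thesis
      using norm_on_unit_vec_pos[OF lattice_norm_norm_on[OF N] j] by (simp add: le_divide_eq)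
  qed
  have "M (S *\<^sub>v z) \<le> (\<Sum>i<n. cmod ((S *\<^sub>v z) $ i) * M (unit_vec n i))"
    by (rule norm_on_le_sum[OF M]) (use S z in simp)
  also have "\<dots> \<le> (\<Sum>i<n. (\<Sum>j<n. cmod (S $$ (i, j)) * (1 / N (unit_vec n j))) * M (unit_vec n i))"
  proof (intro sum_mono mult_right_mono)
    fix i assume i: "i \<in> {..<n}"
    have "cmod ((S *\<^sub>v z) $ i) \<le> (\<Sum>j<n. cmod (S $$ (i, j) * z $ j))"
      using S z i norm_sum[of "\<lambda>j. S $$ (i, j) * z $ j" "{..<n}"] by (simp add: scalar_prod_def atLeast0LessThan)
    also have "\<dots> \<le> (\<Sum>j<n. cmod (S $$ (i, j)) * (1 / N (unit_vec n j)))"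
      unfolding norm_mult by (intro sum_mono mult_left_mono coord) auto
    finally show "cmod ((S *\<^sub>v z) $ i) \<le> (\<Sum>j<n. cmod (S $$ (i, j)) * (1 / N (unit_vec n j)))" .
  qed (simp add: norm_on_nonneg[OF M])
  finally show "M (S *\<^sub>v z) \<le> (\<Sum>i<n. (\<Sum>j<n. cmod (S $$ (i, j)) * (1 / N (unit_vec n j))) * M (unit_vec n i))" .
qed

lemma op_norm_nonneg:
  assumes N: "lattice_norm n N" and M: "norm_on n M" and S: "S \<in> carrier_mat n n"
  shows "0 \<le> op_norm n N M S"
proof -
  have "0\<^sub>v n \<in> {z \<in> carrier_vec n. N z \<le> 1}"
    using norm_on_eq_0[OF lattice_norm_norm_on[OF N], of "0\<^sub>v n"] by simp
  then have "M (S *\<^sub>v 0\<^sub>v n) \<le> op_norm n N M S"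
    unfolding op_norm_def by (intro cSUP_upper op_norm_bdd[OF N M S])
  moreover have "0 \<le> M (S *\<^sub>v 0\<^sub>v n)" by (rule norm_on_nonneg[OF M]) (use S in simp)
  ultimately show ?thesis by simp
qed

lemma op_norm_upper:
  assumes N: "lattice_norm n N" and M: "norm_on n M" and S: "S \<in> carrier_mat n n" and z: "z \<in> carrier_vec n"
  shows "M (S *\<^sub>v z) \<le> op_norm n N M S * N z"
proof (cases "N z = 0")
  case True
  then have "S *\<^sub>v z = 0\<^sub>v n"
    using norm_on_eq_0[OF lattice_norm_norm_on[OF N] z] S by (intro eq_vecI) (auto simp: scalar_prod_def)
  then show ?thesis using True norm_on_eq_0[OF M, of "0\<^sub>v n"] by simp
next
  case False
  then have pos: "N z > 0" using norm_on_nonneg[OF lattice_norm_norm_on[OF N] z] by simp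
  let ?y = "complex_of_real (1 / N z) \<cdot>\<^sub>v z"
  have "N ?y = 1" using norm_on_smult[OF lattice_norm_norm_on[OF N] z] pos by (simp add: norm_divide)
  then have "M (S *\<^sub>v ?y) \<le> op_norm n N M S"
    unfolding op_norm_def using z by (intro cSUP_upper op_norm_bdd[OF N M S]) simp
  moreover have "S *\<^sub>v ?y = complex_of_real (1 / N z) \<cdot>\<^sub>v (S *\<^sub>v z)"
    by (rule mult_mat_vec[OF S z])
  moreover have "M (complex_of_real (1 / N z) \<cdot>\<^sub>v (S *\<^sub>v z)) = M (S *\<^sub>v z) / N z"
    using norm_on_smult[OF M, of "S *\<^sub>v z" "complex_of_real (1 / N z)"] S z pos by (simp add: norm_divide)
  ultimately show ?thesis using pos by (simp add: divide_le_eq)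
qed

text \<open>A diagonal unitary whose entries are powers of an \<open>n\<close>-th root of unity.
  These \<open>n\<close> phase changes can replace an average over the whole torus, because the
  exponents \<open>j < n\<close> are distinct modulo \<open>n\<close>.\<close>

definition twist :: "nat \<Rightarrow> nat \<Rightarrow> complex vec \<Rightarrow> complex vec" where
  "twist n t z = vec n (\<lambda>j. cis (2 * pi * real t / real n) ^ j * z $ j)"

lemma twist_carrier [simp]: "twist n t z \<in> carrier_vec n"
  by (simp add: twist_def)

lemma lattice_norm_twist:
  assumes "lattice_norm n N" "z \<in> carrier_vec n"
  shows "N (twist n t z) = N z"
  by (rule antisym; rule lattice_norm_mono[OF assms(1)])
    (use assms(2) in \<open>auto simp: twist_def norm_mult norm_power\<close>)

text \<open>On average the cross terms between different columns of \<open>S\<close> cancel, which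
  leaves the diagonal operator whose entries are the column norms.\<close>

lemma l2_norm_twist_average:
  assumes S: "S \<in> carrier_mat n n"
  shows "(\<Sum>t<n. (l2_norm n (S *\<^sub>v twist n t z))\<^sup>2)
    = real n * (\<Sum>j<n. (l2_norm n (col S j) * cmod (z $ j))\<^sup>2)"
proof -
  have inner: "(\<Sum>t<n. (cmod ((S *\<^sub>v twist n t z) $ i))\<^sup>2) = real n * (\<Sum>j<n. (cmod (S $$ (i, j) * z $ j))\<^sup>2)"
    if i: "i < n" for i
  proof -
    have e: "(S *\<^sub>v twist n t z) $ i
        = (\<Sum>j<n. cis (2 * pi * real t / real n) ^ j * (S $$ (i, j) * z $ j))" for t
      using S i by (simp add: scalar_prod_def atLeast0LessThan twist_def mult_ac)
    have single: "{j. j < n \<and> j = i} = {i}" if "i < n" for i using that by auto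
    have "complex_of_real (\<Sum>t<n. (cmod ((S *\<^sub>v twist n t z) $ i))\<^sup>2)
        = of_nat n * (\<Sum>k<n. \<Sum>j | j \<in> {..<n} \<and> j = k. (S $$ (i, k) * z $ k) * cnj (S $$ (i, j) * z $ j))"
      unfolding e by (rule root_of_unity_average) auto
    also have "\<dots> = complex_of_real (real n * (\<Sum>j<n. (cmod (S $$ (i, j) * z $ j))\<^sup>2))"
      by (simp add: single complex_norm_square del: of_real_power)
    finally show ?thesis using of_real_eq_iff by blast
  qed
  have "(\<Sum>t<n. (l2_norm n (S *\<^sub>v twist n t z))\<^sup>2) = (\<Sum>i<n. \<Sum>t<n. (cmod ((S *\<^sub>v twist n t z) $ i))\<^sup>2)"
    unfolding l2_norm_power2 by (rule sum.swap)
  also have "\<dots> = real n * (\<Sum>i<n. \<Sum>j<n. (cmod (S $$ (i, j) * z $ j))\<^sup>2)"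
    by (simp add: inner sum_distrib_left)
  also have "(\<Sum>i<n. \<Sum>j<n. (cmod (S $$ (i, j) * z $ j))\<^sup>2) = (\<Sum>j<n. \<Sum>i<n. (cmod (S $$ (i, j) * z $ j))\<^sup>2)"
    by (rule sum.swap)
  also have "\<dots> = (\<Sum>j<n. (l2_norm n (col S j) * cmod (z $ j))\<^sup>2)"
    unfolding power_mult_distrib l2_norm_power2 sum_distrib_right
    using S by (intro sum.cong refl) (simp add: norm_mult power_mult_distrib)
  finally show ?thesis .
qed

text \<open>\<open>N\<close> is invariant under twists, so the upper estimate for \<open>S\<close>
  and the lower estimate coming from \<open>S'\<close> both survive averaging and pass to the
  diagonal operator with entries \<open>s j\<close>. The last claim is the dual form of the lower
  estimate.\<close>

lemma diagonal_factorization: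
  assumes n: "n \<ge> 1" and N: "lattice_norm n N"
    and S: "S \<in> carrier_mat n n" and S': "S' \<in> carrier_mat n n" and inv: "inverts_mat S' S"
  defines "s j \<equiv> l2_norm n (col S j)"
  shows "\<And>j. j < n \<Longrightarrow> s j > 0"
    and "\<And>z. \<lbrakk>z \<in> carrier_vec n; N z \<le> 1\<rbrakk> \<Longrightarrow>
      (\<Sum>j<n. (s j * cmod (z $ j))\<^sup>2) \<le> (op_norm n N (l2_norm n) S)\<^sup>2"
    and "\<And>w. \<lbrakk>w \<in> carrier_vec n; dual_norm n N w \<le> 1\<rbrakk> \<Longrightarrow>
      (\<Sum>j<n. (1 / s j * cmod (w $ j))\<^sup>2) \<le> (op_norm n (l2_norm n) N S')\<^sup>2"
proof -
  note l2 = lattice_norm_l2_norm[of n]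
  note l2n = lattice_norm_norm_on[OF l2] and no = lattice_norm_norm_on[OF N]
  let ?a = "op_norm n N (l2_norm n) S" and ?b = "op_norm n (l2_norm n) N S'"
  have a0: "?a \<ge> 0" by (rule op_norm_nonneg[OF N l2n S])
  have b0: "?b \<ge> 0" by (rule op_norm_nonneg[OF l2 no S'])
  \<comment> \<open>The norm of \<open>S'\<close> enters through this lower bound for
    \<open>S\<close>, in which \<open>z\<close> can be twisted.\<close>
  have upb: "N z \<le> ?b * l2_norm n (S *\<^sub>v z)" if z: "z \<in> carrier_vec n" for z
  proof -
    have "S' * S = 1\<^sub>m n" using inv S' by (auto simp: inverts_mat_def)
    then have "S' *\<^sub>v (S *\<^sub>v z) = z"
      using S S' z by (metis assoc_mult_mat_vec one_mult_mat_vec)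
    then show ?thesis using op_norm_upper[OF l2 no S', of "S *\<^sub>v z"] S z by simp
  qed
  show spos: "s j > 0" if j: "j < n" for j
  proof -
    have "S *\<^sub>v unit_vec n j = col S j" using S j by (intro eq_vecI) auto
    then have "0 < ?b * s j"
      using upb[of "unit_vec n j"] norm_on_unit_vec_pos[OF no j] by (simp add: s_def)
    then show ?thesis using b0 by (simp add: zero_less_mult_iff)
  qed
  have avg: "(\<Sum>t<n. (l2_norm n (S *\<^sub>v twist n t z))\<^sup>2) = real n * (\<Sum>j<n. (s j * cmod (z $ j))\<^sup>2)" for z
    unfolding s_def by (rule l2_norm_twist_average[OF S])
  show "(\<Sum>j<n. (s j * cmod (z $ j))\<^sup>2) \<le> ?a\<^sup>2" if z: "z \<in> carrier_vec n" "N z \<le> 1" for z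
  proof -
    have "(\<Sum>t<n. (l2_norm n (S *\<^sub>v twist n t z))\<^sup>2) \<le> (\<Sum>t<n. ?a\<^sup>2)"
    proof (intro sum_mono power_mono)
      fix t
      have "l2_norm n (S *\<^sub>v twist n t z) \<le> ?a * N z"
        using op_norm_upper[OF N l2n S, of "twist n t z"] lattice_norm_twist[OF N z(1)] by simp
      also have "\<dots> \<le> ?a" using a0 z(2) by (simp add: mult_left_le)
      finally show "l2_norm n (S *\<^sub>v twist n t z) \<le> ?a" .
      show "0 \<le> l2_norm n (S *\<^sub>v twist n t z)" by (rule norm_on_nonneg[OF l2n]) (use S in simp)
    qed
    then show ?thesis using n unfolding avg by simp
  qed
  show "(\<Sum>j<n. (1 / s j * cmod (w $ j))\<^sup>2) \<le> ?b\<^sup>2" if w: "w \<in> carrier_vec n" "dual_norm n N w \<le> 1" for w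
  proof -
    define T where "T = (\<Sum>j<n. (1 / s j * cmod (w $ j))\<^sup>2)"
    \<comment> \<open>The extremal vector: its pairing with \<open>w\<close> and the squared Hilbert
      norm of its diagonal image both equal \<open>T\<close>. Hence \<open>T \<le> N z\<close>, and
      averaging \<open>upb\<close> gives \<open>T * T \<le> ?b\<^sup>2 * T\<close>.\<close>
    define z where "z = vec n (\<lambda>j. complex_of_real (1 / (s j)\<^sup>2) * cnj (w $ j))"
    have zc: "z \<in> carrier_vec n" by (simp add: z_def)
    have T0: "T \<ge> 0" unfolding T_def by (simp add: sum_nonneg)
    have "w \<bullet> z = complex_of_real T"
      unfolding scalar_prod_lessThan[OF zc] T_def of_real_sum
      by (intro sum.cong refl)
        (simp add: z_def power_mult_distrib power_divide complex_norm_square del: of_real_power flip: of_real_power)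
    then have "T \<le> dual_norm n N w * N z" using dual_norm_upper[OF N zc, of w] T0 by simp
    also have "\<dots> \<le> 1 * N z" using w(2) norm_on_nonneg[OF no zc] by (rule mult_right_mono)
    finally have TN: "T \<le> N z" by simp
    have "real n * T\<^sup>2 \<le> (\<Sum>t<n. (?b * l2_norm n (S *\<^sub>v twist n t z))\<^sup>2)"
    proof -
      have "(\<Sum>t<n. T\<^sup>2) \<le> (\<Sum>t<n. (?b * l2_norm n (S *\<^sub>v twist n t z))\<^sup>2)"
      proof (intro sum_mono power_mono T0)
        fix t
        have "N z \<le> ?b * l2_norm n (S *\<^sub>v twist n t z)"
          using upb[of "twist n t z"] lattice_norm_twist[OF N zc] by simp
        then show "T \<le> ?b * l2_norm n (S *\<^sub>v twist n t z)" using TN by simp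
      qed
      then show ?thesis by simp
    qed
    also have "\<dots> = ?b\<^sup>2 * (real n * (\<Sum>j<n. (s j * cmod (z $ j))\<^sup>2))"
      unfolding avg[symmetric] by (simp add: power_mult_distrib sum_distrib_left)
    also have "(\<Sum>j<n. (s j * cmod (z $ j))\<^sup>2) = T"
      unfolding T_def
    proof (intro sum.cong refl)
      fix j assume "j \<in> {..<n}"
      then have j: "j < n" by simp
      have "s j * cmod (z $ j) = 1 / s j * cmod (w $ j)"
        using spos[OF j] j by (simp add: z_def norm_mult norm_divide norm_power power2_eq_square)
      then show "(s j * cmod (z $ j))\<^sup>2 = (1 / s j * cmod (w $ j))\<^sup>2" by simp
    qed
    finally have "real n * (T * T) \<le> real n * (?b\<^sup>2 * T)" by (simp add: power2_eq_square mult_ac)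
    then have "T * T \<le> ?b\<^sup>2 * T" using n by (subst (asm) mult_le_cancel_left_pos) auto
    then have "T \<le> ?b\<^sup>2" using T0 by (cases "T = 0") (auto simp: mult_le_cancel_right)
    then show ?thesis by (simp add: T_def)
  qed
qed

text \<open>Every isomorphism onto the Hilbert space supplies weights through its column norms, so
  the weighted bound holds for each of them and passes to the infimum.\<close>

lemma bohr_product_le_banach_mazur:
  fixes X :: "'x::complex_banach itself" and x :: 'x
  assumes n: "n \<ge> 2" and x: "x \<noteq> 0" and lam: "lam \<ge> 1" and N: "lattice_norm n N"
  shows "bohr_product n N X lam
    \<le> 8 * lam\<^sup>2 * exp 6 * ln (real n) * banach_mazur n N (l2_norm n) / real n"
proof -
  note l2 = lattice_norm_l2_norm[of n]
  define c where "c = 8 * lam\<^sup>2 * exp 6 * ln (real n)"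
  have c: "c > 0" using n lam by (simp add: c_def)
  \<comment> \<open>Solved for the distance, the claim says that the left side is a lower bound of
    the set whose infimum is taken.\<close>
  have "bohr_product n N X lam * real n / c \<le> banach_mazur n N (l2_norm n)"
    unfolding banach_mazur_def
  proof (rule cInf_greatest)
    \<comment> \<open>The identity shows that the set is nonempty, which an infimum of reals
      needs.\<close>
    have "inverts_mat (1\<^sub>m n) (1\<^sub>m n :: complex mat)" by (simp add: inverts_mat_def)
    then show "{op_norm n N (l2_norm n) S * op_norm n (l2_norm n) N S' | S S'.
        S \<in> carrier_mat n n \<and> S' \<in> carrier_mat n n \<and> inverts_mat S S' \<and> inverts_mat S' S} \<noteq> {}"
      using one_carrier_mat by blast
  next
    fix d assume "d \<in> {op_norm n N (l2_norm n) S * op_norm n (l2_norm n) N S' | S S'.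
        S \<in> carrier_mat n n \<and> S' \<in> carrier_mat n n \<and> inverts_mat S S' \<and> inverts_mat S' S}"
    then obtain S S' where d: "d = op_norm n N (l2_norm n) S * op_norm n (l2_norm n) N S'"
      and S: "S \<in> carrier_mat n n" "S' \<in> carrier_mat n n" "inverts_mat S' S" by blast
    have n1: "n \<ge> 1" using n by simp
    note df = diagonal_factorization[OF n1 N S]
    have "bohr_product n N X lam \<le> c * d / real n"
      unfolding c_def d
      by (rule bohr_product_weighted(2)[OF n x lam N df(1) _ _ df(2) df(3)])
        (use op_norm_nonneg[OF N lattice_norm_norm_on[OF l2] S(1)]
          op_norm_nonneg[OF l2 lattice_norm_norm_on[OF N] S(2)] in auto)
    then show "bohr_product n N X lam * real n / c \<le> d"
      using c n by (simp add: field_simps)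
  qed
  then have "bohr_product n N X lam \<le> c * banach_mazur n N (l2_norm n) / real n"
    using c n by (simp add: field_simps)
  then show ?thesis by (simp add: c_def)
qed

section \<open>Nearly extremal diagonal weights\<close>

lemma sum_le_prod_one_plus:
  fixes f :: "'a \<Rightarrow> real"
  assumes "finite A" "\<And>a. a \<in> A \<Longrightarrow> f a \<ge> 0"
  shows "1 + sum f A \<le> (\<Prod>a\<in>A. 1 + f a)"
  using assms
proof (induction A)
  case (insert a A)
  have s0: "sum f A \<ge> 0" using insert by (intro sum_nonneg) auto
  have "1 + sum f (insert a A) \<le> (1 + f a) * (1 + sum f A)"
    using insert s0 by (simp add: algebra_simps)
  also have "\<dots> \<le> (1 + f a) * (\<Prod>a\<in>A. 1 + f a)"
    using insert by (intro mult_left_mono) auto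
  finally show ?case using insert by simp
qed simp

text \<open>A variant of John's theorem.  If \<open>t\<close> nearly maximizes \<open>\<Prod> t\<^sub>i\<close> over the convex set \<open>T\<close>, then
  \<open>\<Sum> t'\<^sub>i/t\<^sub>i\<close> is of order \<open>n\<close> for every \<open>t' \<in> T\<close>; and \<open>T\<close> contains \<open>|w|\<^sup>2\<close> for each \<open>w\<close> in the dual
  ball.  Near maximality spares a compactness argument.\<close>

lemma exists_weights:
  assumes n: "n \<ge> 1" and N: "lattice_norm n N"
  obtains s :: "nat \<Rightarrow> real" where "\<And>i. i < n \<Longrightarrow> s i > 0"
    and "\<And>z. \<lbrakk>z \<in> carrier_vec n; N z \<le> 1\<rbrakk> \<Longrightarrow> (\<Sum>i<n. (s i * cmod (z $ i))\<^sup>2) \<le> 1"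
    and "\<And>w. \<lbrakk>w \<in> carrier_vec n; dual_norm n N w \<le> 1\<rbrakk> \<Longrightarrow>
      (\<Sum>i<n. (1 / s i * cmod (w $ i))\<^sup>2) \<le> 6 * real n"
proof -
  note no = lattice_norm_norm_on[OF N]
  \<comment> \<open>The squared weights for which the diagonal operator into the Hilbert space has
    norm at most 1. In the squares the constraints are linear, hence \<open>T\<close> is
    convex.\<close>
  define T where "T = {t :: nat \<Rightarrow> real. (\<forall>i<n. 0 \<le> t i) \<and>
    (\<forall>z\<in>carrier_vec n. N z \<le> 1 \<longrightarrow> (\<Sum>i<n. t i * (cmod (z $ i))\<^sup>2) \<le> 1)}"
  define p where "p t = (\<Prod>i<n. t i)" for t :: "nat \<Rightarrow> real"
  let ?e = "\<lambda>i. N (unit_vec n i)"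
  have epos: "?e i > 0" if "i < n" for i by (rule norm_on_unit_vec_pos[OF no that])
  have coord: "(cmod (z $ i))\<^sup>2 * (?e i)\<^sup>2 \<le> 1" if z: "z \<in> carrier_vec n" "N z \<le> 1" and i: "i < n" for z i
  proof -
    have "cmod (z $ i) * ?e i \<le> 1" using lattice_norm_coordinate[OF N z(1) i] z(2) by simp
    then have "(cmod (z $ i) * ?e i)\<^sup>2 \<le> 1" using epos[OF i] by (intro power_le_one) auto
    then show ?thesis by (simp add: power_mult_distrib)
  qed
  \<comment> \<open>A point of \<open>T\<close> with positive coordinates, so that the supremum
    \<open>M\<close> is positive.\<close>
  have t0: "(\<lambda>i. (?e i)\<^sup>2 / real n) \<in> T"
    unfolding T_def
  proof (intro CollectI conjI allI impI ballI)
    fix z :: "complex vec" assume z: "z \<in> carrier_vec n" "N z \<le> 1"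
    have "(\<Sum>i<n. (?e i)\<^sup>2 / real n * (cmod (z $ i))\<^sup>2) \<le> (\<Sum>i<n. 1 / real n)"
    proof (rule sum_mono)
      fix i assume "i \<in> {..<n}"
      then show "(?e i)\<^sup>2 / real n * (cmod (z $ i))\<^sup>2 \<le> 1 / real n"
        using coord[OF z, of i] n by (simp add: field_simps)
    qed
    also have "\<dots> = 1" using n by simp
    finally show "(\<Sum>i<n. (?e i)\<^sup>2 / real n * (cmod (z $ i))\<^sup>2) \<le> 1" .
  qed simp
  have bdd: "bdd_above (p ` T)"
  proof (rule bdd_aboveI2)
    fix t assume t: "t \<in> T"
    show "p t \<le> (\<Prod>i<n. (?e i)\<^sup>2)"
      unfolding p_def
    proof (rule prod_mono, intro conjI)
      fix i assume "i \<in> {..<n}"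
      then have i: "i < n" by simp
      show "0 \<le> t i" using t i by (simp add: T_def)
      let ?z = "complex_of_real (1 / ?e i) \<cdot>\<^sub>v unit_vec n i"
      have "N ?z = 1" using norm_on_smult[OF no, of "unit_vec n i"] epos[OF i] by (simp add: norm_divide)
      then have "N ?z \<le> 1" "?z \<in> carrier_vec n" by simp_all
      then have "(\<Sum>j<n. t j * (cmod (?z $ j))\<^sup>2) \<le> 1" using t unfolding T_def by blast
      also have "(\<Sum>j<n. t j * (cmod (?z $ j))\<^sup>2) = (\<Sum>j<n. if j = i then t i / (?e i)\<^sup>2 else 0)"
        using i epos[OF i] by (intro sum.cong refl) (auto simp: norm_divide power_divide)
      finally show "t i \<le> (?e i)\<^sup>2" using i epos[OF i] by (simp add: divide_le_eq)
    qed
  qed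
  define M where "M = Sup (p ` T)"
  have "0 < p (\<lambda>i. (?e i)\<^sup>2 / real n)"
    unfolding p_def using n epos by (intro prod_pos) (auto simp: less_imp_neq[symmetric])
  also have "\<dots> \<le> M" unfolding M_def by (rule cSUP_upper[OF t0 bdd])
  finally have Mpos: "M > 0" .
  \<comment> \<open>Half of the supremum is enough; it accounts for the factor 2 in
    \<open>6 = 3 * 2\<close>.\<close>
  then have "M / 2 < M" by simp
  then obtain t where t: "t \<in> T" "M / 2 < p t"
    using less_cSupD[of "p ` T" "M / 2"] t0 unfolding M_def by blast
  have tnn: "0 \<le> t i" if "i < n" for i using t(1) that by (simp add: T_def)
  have tpos: "t i > 0" if i: "i < n" for i
  proof (rule ccontr)
    assume "\<not> t i > 0"
    then have "t i = 0" using tnn[OF i] by simp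
    then have "p t = 0" unfolding p_def using i by (intro prod_zero) auto
    then show False using t(2) Mpos by simp
  qed
  have key: "(\<Sum>i<n. t' i / t i) \<le> 6 * real n" if t': "t' \<in> T" for t'
  proof -
    have t'nn: "0 \<le> t' i" if "i < n" for i using t' that by (simp add: T_def)
    \<comment> \<open>\<open>y\<close> below is the convex combination of \<open>t\<close> and
      \<open>t'\<close> in the ratio \<open>1 : 1/n\<close>. The step \<open>1/n\<close> keeps
      \<open>q ^ n\<close> at most \<open>exp 1 \<le> 3\<close>.\<close>
    define q where "q = 1 + 1 / real n"
    have q: "q > 0" by (simp add: q_def add_pos_nonneg)
    define y where "y i = (t i + t' i / real n) / q" for i
    have "y \<in> T"
      unfolding T_def
    proof (intro CollectI conjI allI impI ballI)
      show "0 \<le> y i" if "i < n" for i using that tnn t'nn q by (simp add: y_def)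
      fix z :: "complex vec" assume z: "z \<in> carrier_vec n" "N z \<le> 1"
      have 1: "(\<Sum>i<n. t i * (cmod (z $ i))\<^sup>2) \<le> 1" and 2: "(\<Sum>i<n. t' i * (cmod (z $ i))\<^sup>2) \<le> 1"
        using t(1) t' z by (auto simp: T_def)
      have "(\<Sum>i<n. y i * (cmod (z $ i))\<^sup>2)
          = ((\<Sum>i<n. t i * (cmod (z $ i))\<^sup>2) + (\<Sum>i<n. t' i * (cmod (z $ i))\<^sup>2) / real n) / q"
        unfolding y_def sum_divide_distrib sum.distrib[symmetric]
        by (intro sum.cong refl) (simp add: field_simps)
      also have "\<dots> \<le> (1 + 1 / real n) / q"
        using 1 2 q by (intro divide_right_mono add_mono) auto
      finally show "(\<Sum>i<n. y i * (cmod (z $ i))\<^sup>2) \<le> 1" using q by (simp add: q_def)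
    qed
    then have "p y \<le> M" unfolding M_def by (rule cSUP_upper[OF _ bdd])
    then have py: "p y < 2 * p t" using t(2) by simp
    have "p t * (\<Prod>i<n. 1 + t' i / t i / real n) = q ^ n * p y"
    proof -
      have "q ^ n * p y = (\<Prod>i<n. q * y i)" by (simp add: p_def prod.distrib)
      also have "\<dots> = (\<Prod>i<n. t i * (1 + t' i / t i / real n))"
      proof (intro prod.cong refl)
        fix i assume "i \<in> {..<n}"
        then have "t i > 0" using tpos by simp
        moreover have "q * y i = t i + t' i / real n" using q by (simp add: y_def)
        ultimately show "q * y i = t i * (1 + t' i / t i / real n)" by (simp add: distrib_left)
      qed
      finally show ?thesis by (simp add: p_def prod.distrib)
    qed
    also have "\<dots> \<le> 3 * (2 * p t)"
    proof (rule mult_mono)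
      have "q \<le> exp (1 / real n)" unfolding q_def by (rule exp_ge_add_one_self)
      then have "q ^ n \<le> exp (1 / real n) ^ n" using q by (intro power_mono) auto
      also have "\<dots> = exp 1" using n by (simp flip: exp_of_nat_mult)
      also have "\<dots> \<le> 3" by (rule exp_le)
      finally show "q ^ n \<le> 3" .
      show "0 \<le> p y" using \<open>y \<in> T\<close> unfolding p_def by (intro prod_nonneg) (auto simp: T_def)
    qed (use py in auto)
    finally have "p t * (\<Prod>i<n. 1 + t' i / t i / real n) \<le> p t * 6" by simp
    moreover have "p t > 0" using t(2) Mpos by simp
    ultimately have "(\<Prod>i<n. 1 + t' i / t i / real n) \<le> 6" by simp
    \<comment> \<open>The bound for the product becomes one for the sum, since multiplying out gives
      1, the sum and nonnegative terms.\<close>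
    moreover have "1 + (\<Sum>i<n. t' i / t i / real n) \<le> (\<Prod>i<n. 1 + t' i / t i / real n)"
      by (rule sum_le_prod_one_plus) (use tpos t'nn in \<open>auto simp: less_imp_le\<close>)
    ultimately have "(\<Sum>i<n. t' i / t i) / real n \<le> 6" by (simp add: sum_divide_distrib)
    then show ?thesis using n by (simp add: divide_le_eq)
  qed
  show ?thesis
  proof (rule that[of "\<lambda>i. sqrt (t i)"])
    show "0 < sqrt (t i)" if "i < n" for i using tpos[OF that] by simp
    show "(\<Sum>i<n. (sqrt (t i) * cmod (z $ i))\<^sup>2) \<le> 1" if "z \<in> carrier_vec n" "N z \<le> 1" for z
    proof -
      have "(\<Sum>i<n. (sqrt (t i) * cmod (z $ i))\<^sup>2) = (\<Sum>i<n. t i * (cmod (z $ i))\<^sup>2)"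
        by (intro sum.cong refl) (simp add: power_mult_distrib tnn)
      then show ?thesis using t(1) that by (simp add: T_def)
    qed
    fix w assume w: "w \<in> carrier_vec n" "dual_norm n N w \<le> 1"
    have "(\<lambda>i. (cmod (w $ i))\<^sup>2) \<in> T"
      unfolding T_def
    proof (intro CollectI conjI allI impI ballI)
      fix z :: "complex vec" assume z: "z \<in> carrier_vec n" "N z \<le> 1"
      \<comment> \<open>A sum of squares is at most the square of the sum, and
        \<open>dual_norm_pairing\<close> bounds the sum by 1.\<close>
      have "(\<Sum>i<n. (cmod (w $ i))\<^sup>2 * (cmod (z $ i))\<^sup>2) = (L2_set (\<lambda>i. cmod (w $ i) * cmod (z $ i)) {..<n})\<^sup>2"
        unfolding L2_set_def by (simp add: power_mult_distrib sum_nonneg)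
      also have "\<dots> \<le> 1"
      proof (rule power_le_one)
        have "L2_set (\<lambda>i. cmod (w $ i) * cmod (z $ i)) {..<n} \<le> (\<Sum>i<n. cmod (w $ i) * cmod (z $ i))"
          by (rule L2_set_le_sum) simp
        also have "\<dots> \<le> dual_norm n N w * N z" by (rule dual_norm_pairing[OF N z(1)])
        also have "\<dots> \<le> 1" using w(2) z(2) dual_norm_nonneg[OF N] norm_on_nonneg[OF no z(1)]
          by (simp add: mult_le_one)
        finally show "L2_set (\<lambda>i. cmod (w $ i) * cmod (z $ i)) {..<n} \<le> 1" .
      qed (rule L2_set_nonneg)
      finally show "(\<Sum>i<n. (cmod (w $ i))\<^sup>2 * (cmod (z $ i))\<^sup>2) \<le> 1" .
    qed simp
    then have "(\<Sum>i<n. (cmod (w $ i))\<^sup>2 / t i) \<le> 6 * real n" by (rule key)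
    moreover have "(\<Sum>i<n. (1 / sqrt (t i) * cmod (w $ i))\<^sup>2) = (\<Sum>i<n. (cmod (w $ i))\<^sup>2 / t i)"
      by (intro sum.cong refl) (simp add: power_mult_distrib power_divide tnn)
    ultimately show "(\<Sum>i<n. (1 / sqrt (t i) * cmod (w $ i))\<^sup>2) \<le> 6 * real n" by simp
  qed
qed

section \<open>The bound by the distance and the limit of the products\<close>

theorem theorem2p14:
  fixes N :: "nat \<Rightarrow> complex vec \<Rightarrow> real"
    and X :: "'x::complex_banach itself"
    and lam :: real
  assumes "\<And>n. n \<ge> 1 \<Longrightarrow> symmetric_space n (N n)"
    and "\<And>n. n \<ge> 1 \<Longrightarrow> unconditional_basis n (N n) (unit_vec n)"
    and "\<And>n. n \<ge> 1 \<Longrightarrow> unconditional_const n (N n) (unit_vec n) = 1"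
    and "\<exists>x::'x. x \<noteq> 0"
    and "lam \<ge> 1"
  shows "(\<forall>n\<ge>2. bohr_product n (N n) X lam
            \<le> (8 * lam\<^sup>2 * exp 6 * ln (real n)) * banach_mazur n (N n) (l2_norm n) / real n)
         \<and> (\<lambda>n. bohr_product n (N n) X lam) \<longlonglongrightarrow> 0"
proof -
  obtain x :: 'x where x: "x \<noteq> 0" using assms(4) by blast
  have N: "lattice_norm n (N n)" if "n \<ge> 1" for n
    using that assms(1-3)[of n] by (intro lattice_norm_of_unconditional) (auto simp: symmetric_space_def)
  \<comment> \<open>For the limit, the weights of \<open>exists_weights\<close> give
    \<open>A = 1\<close> and \<open>B = sqrt (6 * n)\<close>, hence directly a bound of order
    \<open>ln n / sqrt n\<close>, without estimating the distance.\<close>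
  have bounds: "0 \<le> bohr_product n (N n) X lam \<and>
      bohr_product n (N n) X lam \<le> 8 * lam\<^sup>2 * exp 6 * ln (real n) * (1 * sqrt (6 * real n)) / real n"
    if n: "n \<ge> 2" for n
  proof -
    have n1: "n \<ge> 1" using n by simp
    obtain s :: "nat \<Rightarrow> real" where s: "\<And>i. i < n \<Longrightarrow> s i > 0"
      and s1: "\<And>z. \<lbrakk>z \<in> carrier_vec n; N n z \<le> 1\<rbrakk> \<Longrightarrow> (\<Sum>i<n. (s i * cmod (z $ i))\<^sup>2) \<le> 1"
      and s2: "\<And>w. \<lbrakk>w \<in> carrier_vec n; dual_norm n (N n) w \<le> 1\<rbrakk> \<Longrightarrow>
        (\<Sum>i<n. (1 / s i * cmod (w $ i))\<^sup>2) \<le> 6 * real n"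
      using exists_weights[OF n1 N[OF n1]] by blast
    have "(\<Sum>i<n. (s i * cmod (z $ i))\<^sup>2) \<le> 1\<^sup>2" if "z \<in> carrier_vec n" "N n z \<le> 1" for z
      using s1[OF that] by simp
    moreover have "(\<Sum>i<n. (1 / s i * cmod (w $ i))\<^sup>2) \<le> (sqrt (6 * real n))\<^sup>2"
      if "w \<in> carrier_vec n" "dual_norm n (N n) w \<le> 1" for w
      using s2[OF that] by simp
    ultimately show ?thesis
      using 
        bohr_product_weighted[where s = s and A = 1 and B = "sqrt (6 * real n)" and X = X,
          OF n x assms(5) N[OF n1] s zero_le_one] by simp
  qed
  have "(\<lambda>n. bohr_product n (N n) X lam) \<longlonglongrightarrow> 0"
  proof (rule tendsto_sandwich)
    show "\<forall>\<^sub>F n in sequentially. 0 \<le> bohr_product n (N n) X lam"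
      using eventually_ge_at_top[of 2] by eventually_elim (use bounds in blast)
    show "\<forall>\<^sub>F n in sequentially. bohr_product n (N n) X lam
        \<le> 8 * lam\<^sup>2 * exp 6 * (ln (real n) * sqrt (6 * real n) / real n)"
      using eventually_ge_at_top[of 2] by eventually_elim (use bounds in \<open>simp add: mult.assoc\<close>)
    have "(\<lambda>n. ln (real n) * sqrt (6 * real n) / real n) \<longlonglongrightarrow> 0" by real_asymp
    then show "(\<lambda>n. 8 * lam\<^sup>2 * exp 6 * (ln (real n) * sqrt (6 * real n) / real n)) \<longlonglongrightarrow> 0"
      by (rule tendsto_mult_right_zero)
  qed simp
  then show ?thesis
    using bohr_product_le_banach_mazur[OF _ x assms(5) N] by auto
qed

end
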